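(* Let $\kappa$ be a regular uncountable cardinal such that $\kappa^{<\kappa}=\kappa$ and $2^\kappa=\kappa^+$. Assume that $\boxtimes^*_\kappa(\kappa^+\cap\mathrm{cof}(\kappa))$ holds. Then there exist two normal $\kappa$-complete $\mathbb{R}_\kappa$-embeddable $\kappa^+$-Aronszajn trees which are not club isomorphic.
   Context: A $\kappa^+$-tree is a tree of height $\kappa^+$ all of whose levels have size $<\kappa^+$; it is Aronszajn if it has no cofinal branch. A tree is $\kappa$-complete if every chain of order type $<\kappa$ has an upper bound. A $\lambda$-tree $T$ is normal if (i) for every $x\in T$ and $\gamma<\lambda$ above $\mathrm{ht}_T(x)$ there is $y>_Tx$ of height $\gamma$; (ii) distinct nodes of the same limit height have distinct sets of predecessors; (iii) every node has two incomparable nodes above it. For a set $C$ of ordinals, $T\restriction C=\{x\in T:\mathrm{ht}_T(x)\in C\}$. Two $\lambda$-trees $T,U$ are club isomorphic if there is a club $C\subseteq\lambda$ and an isomorphism (order-preserving and reflecting bijection) $T\restriction C\to U\restriction C$. $\mathbb{Q}_\kappa$ is the set of functions $f:\kappa\to2$ with $\{\alpha:f(\alpha)=1\}$ nonempty of size $<\kappa$, ordered lexicographically; $\mathbb{R}_\kappa$ is its Dedekind completion. $T$ is $\mathbb{R}_\kappa$-embeddable if there is $f:T\to\mathbb{R}_\kappa$ with $x<_Ty\Rightarrow f(x)<f(y)$. For a stationary $S\subseteq\kappa^+\cap\mathrm{cof}(\kappa)$, $\boxtimes^*_\kappa(S)$ asserts the existence of $\langle C_\delta:\delta<\kappa^+\rangle$,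 each $C_\delta$ club in $\delta$ of order type $\le\kappa$, such that for every unbounded $X\subseteq\kappa^+$ there are stationarily many $\delta\in S$ with $(C_\delta\cap X)\setminus\lim(C_\delta)$ cofinal in $\delta$. *)

theory Defs
  imports Main
begin

unbundle cardinal_syntax

text \<open>
  Ordinals and cardinals follow the conventions of the BNF theories: they are reflexive
  well-order relations, and the ordinals below \<open>l\<close> are the elements of \<open>Field l\<close>, the element
  \<open>d\<close> standing for the order type of \<open>underS l d\<close>.  The parameter \<open>D\<close> of \<open>unbounded_in\<close>
  and \<open>club_in\<close> is the ordinal in which the set is unbounded or club: \<open>Field l\<close> for the
  ordinal \<open>l\<close> itself, \<open>underS l d\<close> for the ordinal \<open>d\<close>.

  The inequality in \<open>unbounded_in\<close> is deliberately not strict, so that zero and successor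
  ordinals have clubs (the sequences in \<open>boxtimes_star\<close> range over all \<open>\<delta> < \<kappa>\<^sup>+\<close>).
  On limit ordinals this agrees with the strict version.
\<close>
definition unbounded_in :: "'o rel \<Rightarrow> 'o set \<Rightarrow> 'o set \<Rightarrow> bool" where
  "unbounded_in l D X \<longleftrightarrow> X \<subseteq> D \<and> (\<forall>b\<in>D. \<exists>c\<in>X. (b, c) \<in> l)"

definition limit_points :: "'o rel \<Rightarrow> 'o set \<Rightarrow> 'o set" where
  "limit_points l X =
    {d \<in> Field l. underS l d \<noteq> {} \<and> (\<forall>b\<in>underS l d. \<exists>c\<in>X \<inter> underS l d. c \<in> aboveS l b)}"

definition limit_ordinal :: "'o rel \<Rightarrow> 'o \<Rightarrow> bool" where
  "limit_ordinal l d \<longleftrightarrow>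
    d \<in> Field l \<and> underS l d \<noteq> {} \<and> (\<forall>b\<in>underS l d. \<exists>c\<in>underS l d. c \<in> aboveS l b)"

definition club_in :: "'o rel \<Rightarrow> 'o set \<Rightarrow> 'o set \<Rightarrow> bool" where
  "club_in l D C \<longleftrightarrow> unbounded_in l D C \<and> limit_points l C \<inter> D \<subseteq> C"

definition stationary :: "'o rel \<Rightarrow> 'o set \<Rightarrow> bool" where
  "stationary l S \<longleftrightarrow> S \<subseteq> Field l \<and> (\<forall>C. club_in l (Field l) C \<longrightarrow> S \<inter> C \<noteq> {})"

text \<open>The ordinals below \<open>l\<close> whose cofinality, the least order type of an unbounded subset, is \<open>k\<close>.\<close>
definition cof_points :: "'o rel \<Rightarrow> 'a rel \<Rightarrow> 'o set" where
  "cof_points l k =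
    {d \<in> Field l.
      (\<exists>X. unbounded_in l (underS l d) X \<and> Restr l X =o k) \<and>
      (\<forall>X. unbounded_in l (underS l d) X \<longrightarrow> k \<le>o Restr l X)}"

definition boxtimes_star :: "'a rel \<Rightarrow> 'a set set \<Rightarrow> bool" where
  "boxtimes_star k S \<longleftrightarrow>
    (let l = cardSuc k in
      \<exists>C :: 'a set \<Rightarrow> 'a set set.
        (\<forall>d\<in>Field l. club_in l (underS l d) (C d) \<and> Restr l (C d) \<le>o k) \<and>
        (\<forall>X. unbounded_in l (Field l) X \<longrightarrow>
          stationary l
            {d \<in> S. unbounded_in l (underS l d) ((C d \<inter> X) - limit_points l (C d))}))"

text \<open>
  The set of all sequences of length \<open>< \<kappa>\<close> with values in \<open>\<kappa>\<close>, whose cardinality is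
  \<open>\<kappa>\<^bsup><\<kappa>\<^esup>\<close>.  The length is recorded because functions in \<open>Func\<close> take a default value
  outside their domain.
\<close>
definition short_sequences :: "'a rel \<Rightarrow> ('a \<times> ('a \<Rightarrow> 'a)) set" where
  "short_sequences k = (SIGMA a : Field k. Func (underS k a) (Field k))"

text \<open>A tree is represented by its reflexive order \<open>t\<close>; its nodes are the elements of \<open>Field t\<close>.\<close>
definition is_tree :: "'b rel \<Rightarrow> bool" where
  "is_tree t \<longleftrightarrow> Partial_order t \<and> (\<forall>x\<in>Field t. well_order_on (underS t x) (Restr t (underS t x)))"

text \<open>
  The height of a node is the order type of its predecessors; \<open>level l t a\<close> consists of the
  nodes of height \<open>a\<close>.
\<close>
definition level :: "'o rel \<Rightarrow> 'b rel \<Rightarrow> 'o \<Rightarrow> 'b set" where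
  "level l t a = {x \<in> Field t. Restr t (underS t x) =o Restr l (underS l a)}"

text \<open>
  The third and fourth conjunct say that the height of the tree, i.e. the least ordinal whose
  level is empty, is \<open>l\<close>.
\<close>
definition lambda_tree :: "'o rel \<Rightarrow> 'b rel \<Rightarrow> bool" where
  "lambda_tree l t \<longleftrightarrow>
    is_tree t \<and>
    (\<forall>a\<in>Field l. |level l t a| <o l) \<and>
    (\<forall>a\<in>Field l. level l t a \<noteq> {}) \<and>
    Field t = (\<Union>a\<in>Field l. level l t a)"

text \<open>A chain meeting all levels is automatically downward closed and maximal.\<close>
definition cofinal_branch :: "'o rel \<Rightarrow> 'b rel \<Rightarrow> 'b set \<Rightarrow> bool" where
  "cofinal_branch l t B \<longleftrightarrow> B \<in> Chains t \<and> (\<forall>a\<in>Field l. B \<inter> level l t a \<noteq> {})"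

definition aronszajn_tree :: "'o rel \<Rightarrow> 'b rel \<Rightarrow> bool" where
  "aronszajn_tree l t \<longleftrightarrow> lambda_tree l t \<and> (\<nexists>B. cofinal_branch l t B)"

definition complete_tree :: "'a rel \<Rightarrow> 'b rel \<Rightarrow> bool" where
  "complete_tree k t \<longleftrightarrow> (\<forall>c\<in>Chains t. Restr t c <o k \<longrightarrow> (\<exists>u\<in>Field t. \<forall>x\<in>c. (x, u) \<in> t))"

definition normal_tree :: "'o rel \<Rightarrow> 'b rel \<Rightarrow> bool" where
  "normal_tree l t \<longleftrightarrow>
    (\<forall>a\<in>Field l. \<forall>x\<in>level l t a. \<forall>g\<in>aboveS l a. \<exists>y\<in>level l t g. y \<in> aboveS t x) \<and>
    (\<forall>a. limit_ordinal l a \<longrightarrow>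
      (\<forall>x\<in>level l t a. \<forall>y\<in>level l t a. x \<noteq> y \<longrightarrow> underS t x \<noteq> underS t y)) \<and>
    (\<forall>x\<in>Field t. \<exists>y\<in>aboveS t x. \<exists>z\<in>aboveS t x. (y, z) \<notin> t \<and> (z, y) \<notin> t)"

definition tree_restrict :: "'o rel \<Rightarrow> 'b rel \<Rightarrow> 'o set \<Rightarrow> 'b set" where
  "tree_restrict l t C = (\<Union>a\<in>C. level l t a)"

definition club_isomorphic :: "'o rel \<Rightarrow> 'b rel \<Rightarrow> 'c rel \<Rightarrow> bool" where
  "club_isomorphic l t u \<longleftrightarrow>
    (\<exists>C f. club_in l (Field l) C \<and>
      bij_betw f (tree_restrict l t C) (tree_restrict l u C) \<and>
      (\<forall>x\<in>tree_restrict l t C. \<forall>y\<in>tree_restrict l t C. (x, y) \<in> t \<longleftrightarrow> (f x, f y) \<in> u))"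

definition Q_carrier :: "'a rel \<Rightarrow> ('a \<Rightarrow> bool) set" where
  "Q_carrier k =
    {f \<in> Func (Field k) UNIV. {a \<in> Field k. f a} \<noteq> {} \<and> |{a \<in> Field k. f a}| <o k}"

definition Q_order :: "'a rel \<Rightarrow> ('a \<Rightarrow> bool) rel" where
  "Q_order k =
    {(f, g) \<in> Q_carrier k \<times> Q_carrier k.
      f = g \<or> (\<exists>a\<in>Field k. (\<forall>b\<in>underS k a. f b = g b) \<and> \<not> f a \<and> g a)}"

text \<open>
  The Dedekind completion of a linear order, without added endpoints: the elements are
  the lower halves of cuts, i.e. the nonempty sets \<open>A\<close> that are bounded above and contain
  all lower bounds of their set of upper bounds, ordered by inclusion.
  An element \<open>q\<close> of the order corresponds to \<open>under r q\<close>.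
\<close>
definition dedekind_completion :: "'b rel \<Rightarrow> 'b set rel" where
  "dedekind_completion r =
    (let cuts = {A. A \<noteq> {} \<and> Above r A \<noteq> {} \<and> A = Under r (Above r A)}
     in {(A, B) \<in> cuts \<times> cuts. A \<subseteq> B})"

definition R_order :: "'a rel \<Rightarrow> ('a \<Rightarrow> bool) set rel" where
  "R_order k = dedekind_completion (Q_order k)"

definition R_embeddable :: "'a rel \<Rightarrow> 'b rel \<Rightarrow> bool" where
  "R_embeddable k t \<longleftrightarrow>
    (\<exists>f. (\<forall>x\<in>Field t. f x \<in> Field (R_order k)) \<and>
      (\<forall>x y. (x, y) \<in> t \<and> x \<noteq> y \<longrightarrow> (f x, f y) \<in> R_order k \<and> f x \<noteq> f y))"

end

theory Submission
  imports Defs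
begin

text \<open>
  The nodes of all trees are bounded well-ordered subsets of a copy of \<open>\<rat>\<^sub>\<kappa>\<close>, ordered by
  end-extension, with the order type as height. There is no cofinal branch since
  \<open>|\<rat>\<^sub>\<kappa>| = \<kappa>\<close>, and the supremum is a map into \<open>\<real>\<^sub>\<kappa>\<close>. The levels of cofinality below \<open>\<kappa>\<close>
  are forced by completeness. At a level \<open>\<delta>\<close> of cofinality \<open>\<kappa>\<close> one is free to choose the at
  most \<open>\<kappa>\<close> branches that are extended, and they are built by climbing along \<open>C\<^sub>\<delta>\<close>.

  Given any \<open>\<kappa>\<^sup>+\<close>-tree \<open>U\<close>, this freedom produces a tree \<open>T\<close> that is not club isomorphic to
  \<open>U\<close>. Since \<open>2\<^sup>\<kappa> = \<kappa>\<^sup>+\<close> and \<open>\<kappa>\<^bsup><\<kappa>\<^esup> = \<kappa>\<close>, the restriction of a club isomorphism \<open>f\<close> to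
  \<open>T\<close> below \<open>c\<close> is among \<open>\<kappa>\<close> many candidates for unboundedly many \<open>c\<close> of countable
  cofinality, hence it is always the \<open>\<xi>\<close>-th candidate on an unbounded set \<open>X\<close>. At every
  non-accumulation point \<open>c\<close> of \<open>C\<^sub>\<delta>\<close> the \<open>\<xi>\<close>-th branch of level \<open>\<delta>\<close> moves to a node whose
  image under the \<open>\<xi>\<close>-th candidate is not below the first few nodes of level \<open>\<delta>\<close> of \<open>U\<close>; this is
  possible because nodes have \<open>\<kappa>\<close> many pairwise incomparable extensions. If \<open>X\<close> is cofinal in
  the non-accumulation points of \<open>C\<^sub>\<delta>\<close>, then \<open>f\<close> has no value left for that branch.
  Applying this twice, with \<open>U\<close> in turn a first such tree, gives the two trees.
\<close>

section \<open>Initial segments and heights in a linear order\<close>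

locale linear_rel =
  fixes r :: "'b rel"
  assumes lin: "Linear_order r"
begin

definition lt :: "'b \<Rightarrow> 'b \<Rightarrow> bool" where
  "lt a b \<longleftrightarrow> (a, b) \<in> r \<and> a \<noteq> b"

lemma le_refl: "a \<in> Field r \<Longrightarrow> (a, a) \<in> r"
  using lin by (auto simp: order_on_defs refl_on_def)

lemma le_trans: "(a, b) \<in> r \<Longrightarrow> (b, c) \<in> r \<Longrightarrow> (a, c) \<in> r"
  using lin unfolding order_on_defs trans_def by blast

lemma le_antisym: "(a, b) \<in> r \<Longrightarrow> (b, a) \<in> r \<Longrightarrow> a = b"
  using lin unfolding order_on_defs antisym_def by blast

lemma le_total: "a \<in> Field r \<Longrightarrow> b \<in> Field r \<Longrightarrow> (a, b) \<in> r \<or> (b, a) \<in> r"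
  using lin le_refl unfolding order_on_defs total_on_def by metis

lemma le_Field: "(a, b) \<in> r \<Longrightarrow> a \<in> Field r" "(a, b) \<in> r \<Longrightarrow> b \<in> Field r"
  by (auto simp: Field_def)

lemma lt_Field: "lt a b \<Longrightarrow> a \<in> Field r" "lt a b \<Longrightarrow> b \<in> Field r"
  by (auto simp: Field_def lt_def)

lemma lt_le: "lt a b \<Longrightarrow> (a, b) \<in> r"
  by (simp add: lt_def)

lemma lt_irrefl: "\<not> lt a a"
  by (simp add: lt_def)

lemma lt_le_trans: "lt a b \<Longrightarrow> (b, c) \<in> r \<Longrightarrow> lt a c"
  unfolding lt_def using le_trans le_antisym by blast

lemma le_lt_trans: "(a, b) \<in> r \<Longrightarrow> lt b c \<Longrightarrow> lt a c"
  unfolding lt_def using le_trans le_antisym by blast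

lemma lt_trans: "lt a b \<Longrightarrow> lt b c \<Longrightarrow> lt a c"
  using lt_le_trans lt_le by blast

lemma not_lt: "a \<in> Field r \<Longrightarrow> b \<in> Field r \<Longrightarrow> \<not> lt a b \<longleftrightarrow> (b, a) \<in> r"
  unfolding lt_def using le_total le_antisym by blast

lemma not_le: "a \<in> Field r \<Longrightarrow> b \<in> Field r \<Longrightarrow> (b, a) \<notin> r \<longleftrightarrow> lt a b"
  using not_lt by blast

lemma underS_lt: "underS r b = {a. lt a b}"
  by (auto simp: underS_def lt_def)

lemma aboveS_lt: "aboveS r b = {a. lt b a}"
  by (auto simp: aboveS_def lt_def)

text \<open>\<open>B\<close> end-extends \<open>A\<close>; this relation will be the tree
  order.\<close>

definition initial :: "'b set \<Rightarrow> 'b set \<Rightarrow> bool" where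
  "initial A B \<longleftrightarrow> A \<subseteq> B \<and> (\<forall>a\<in>A. \<forall>b\<in>B. (b, a) \<in> r \<longrightarrow> b \<in> A)"

definition well_ordered :: "'b set set" where
  "well_ordered = {A. A \<subseteq> Field r \<and> well_order_on A (Restr r A)}"

lemma initial_refl [simp]: "initial A A"
  by (simp add: initial_def)

lemma initial_subset: "initial A B \<Longrightarrow> A \<subseteq> B"
  by (simp add: initial_def)

lemma initial_trans: "initial A B \<Longrightarrow> initial B C \<Longrightarrow> initial A C"
  unfolding initial_def by blast

lemma initial_antisym: "initial A B \<Longrightarrow> initial B A \<Longrightarrow> A = B"
  unfolding initial_def by blast

lemma initial_restrict: "initial A C \<Longrightarrow> A \<subseteq> B \<Longrightarrow> B \<subseteq> C \<Longrightarrow> initial A B"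
  unfolding initial_def by blast

lemma initial_empty [simp]: "initial {} A"
  by (simp add: initial_def)

lemma initial_comparable:
  assumes "initial A C" "initial B C" "C \<subseteq> Field r"
  shows "initial A B \<or> initial B A"
proof (rule ccontr)
  assume "\<not> ?thesis"
  then obtain a b where "a \<in> A" "a \<notin> B" "b \<in> B" "b \<notin> A"
    using assms unfolding initial_def by blast
  then show False
    using assms le_total[of a b] unfolding initial_def by blast
qed

lemma initial_below: "B \<subseteq> Field r \<Longrightarrow> initial {x \<in> B. lt x b} B"
  unfolding initial_def using le_lt_trans by blast

lemma well_orderedD: "A \<in> well_ordered \<Longrightarrow> A \<subseteq> Field r"
  by (simp add: well_ordered_def)

text \<open>Restrictions of a linear order are linear, so only well-foundedness of the strict part
  is at stake, and in a total order minimal elements are least.\<close>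

lemma well_ordered_iff: "A \<in> well_ordered \<longleftrightarrow> A \<subseteq> Field r \<and> (\<forall>X. X \<subseteq> A \<and> X \<noteq> {} \<longrightarrow> (\<exists>m\<in>X. \<forall>x\<in>X. (m, x) \<in> r))"
proof -
  have *: "well_order_on A (Restr r A) \<longleftrightarrow> wf (Restr r A - Id)" if "A \<subseteq> Field r"
  proof -
    have "linear_order_on A (Restr r A)"
      using Linear_order_Restr[OF lin, of A] Refl_Field_Restr2[of r A] that lin
      by (simp add: order_on_defs)
    then show ?thesis by (simp add: well_order_on_def)
  qed
  have "wf (Restr r A - Id) \<longleftrightarrow> (\<forall>X. X \<subseteq> A \<and> X \<noteq> {} \<longrightarrow> (\<exists>m\<in>X. \<forall>x\<in>X. (m, x) \<in> r))" if sub: "A \<subseteq> Field r"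
  proof
    assume wf: "wf (Restr r A - Id)"
    show "\<forall>X. X \<subseteq> A \<and> X \<noteq> {} \<longrightarrow> (\<exists>m\<in>X. \<forall>x\<in>X. (m, x) \<in> r)"
    proof (intro allI impI)
      fix X assume X: "X \<subseteq> A \<and> X \<noteq> {}"
      then obtain m where m: "m \<in> X" "\<And>y. (y, m) \<in> Restr r A - Id \<Longrightarrow> y \<notin> X"
        using wfE_min'[OF wf, of X] by blast
      have "(m, x) \<in> r" if "x \<in> X" for x
        using m that X sub le_total[of m x] by blast
      then show "\<exists>m\<in>X. \<forall>x\<in>X. (m, x) \<in> r" using m by blast
    qed
  next
    assume H: "\<forall>X. X \<subseteq> A \<and> X \<noteq> {} \<longrightarrow> (\<exists>m\<in>X. \<forall>x\<in>X. (m, x) \<in> r)"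
    show "wf (Restr r A - Id)"
    proof (rule wfI_min)
      fix x X assume "x \<in> (X :: 'b set)"
      show "\<exists>z\<in>X. \<forall>y. (y, z) \<in> Restr r A - Id \<longrightarrow> y \<notin> X"
      proof (cases "X \<inter> A = {}")
        case True then show ?thesis using \<open>x \<in> X\<close> by blast
      next
        case False
        then obtain m where "m \<in> X \<inter> A" "\<forall>x\<in>X\<inter>A. (m, x) \<in> r" using H[rule_format, of "X \<inter> A"] by blast
        then show ?thesis using le_antisym by blast
      qed
    qed
  qed
  then show ?thesis using * by (auto simp: well_ordered_def)
qed

lemma well_ordered_least: "A \<in> well_ordered \<Longrightarrow> X \<subseteq> A \<Longrightarrow> X \<noteq> {} \<Longrightarrow> \<exists>m\<in>X. \<forall>x\<in>X. (m, x) \<in> r"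
  by (simp add: well_ordered_iff)

lemma well_ordered_subset: "B \<in> well_ordered \<Longrightarrow> A \<subseteq> B \<Longrightarrow> A \<in> well_ordered"
  unfolding well_ordered_iff by (meson subset_trans)

lemma well_ordered_ini: "B \<in> well_ordered \<Longrightarrow> initial A B \<Longrightarrow> A \<in> well_ordered"
  using well_ordered_subset initial_subset by blast

lemma well_ordered_empty [simp]: "{} \<in> well_ordered"
  by (simp add: well_ordered_iff)

lemma well_ordered_Well_order: "A \<in> well_ordered \<Longrightarrow> Well_order (Restr r A)"
  unfolding well_ordered_def using well_order_on_Well_order by blast

lemma well_ordered_Field_Restr: "A \<in> well_ordered \<Longrightarrow> Field (Restr r A) = A"
  unfolding well_ordered_def using well_order_on_Well_order by blast

text \<open>The least element of \<open>B\<close> missing from \<open>A\<close> is where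
  \<open>B\<close> leaves \<open>A\<close>.\<close>

lemma initial_proper:
  assumes "initial A B" "A \<noteq> B" "B \<in> well_ordered"
  obtains b where "b \<in> B" "b \<notin> A" "A = {x \<in> B. lt x b}"
proof -
  obtain b where b: "b \<in> B - A" "\<forall>x\<in>B-A. (b, x) \<in> r"
    using well_ordered_least[OF assms(3), of "B - A"] assms unfolding initial_def by blast
  have "A = {x \<in> B. lt x b}"
  proof (intro equalityI subsetI CollectI conjI)
    fix x assume x: "x \<in> A"
    then show "x \<in> B" using assms initial_subset by blast
    then have "x \<in> Field r" "b \<in> Field r" using b well_orderedD[OF assms(3)] by blast+
    moreover have "(b, x) \<notin> r" using x b assms(1) unfolding initial_def by blast
    ultimately show "lt x b" using not_le by blast
  next
    fix x assume x: "x \<in> {x \<in> B. lt x b}"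
    show "x \<in> A"
    proof (rule ccontr)
      assume "x \<notin> A"
      then have "(b, x) \<in> r" using b x by blast
      then show False using x lt_le_trans lt_irrefl by blast
    qed
  qed
  then show ?thesis using b that by blast
qed

lemma initial_Union:
  assumes "\<And>A B. A \<in> c \<Longrightarrow> B \<in> c \<Longrightarrow> initial A B \<or> initial B A" "A \<in> c"
  shows "initial A (\<Union>c)"
  unfolding initial_def
proof (intro conjI ballI impI)
  fix a b assume ab: "a \<in> A" "b \<in> \<Union>c" "(b, a) \<in> r"
  then obtain B where "B \<in> c" "b \<in> B" by blast
  then show "b \<in> A" using assms(1)[of A B] assms(2) ab unfolding initial_def by blast
qed (use assms in blast)

text \<open>Later members of the chain only add elements on top. So if \<open>A\<close> is a member
  that meets \<open>X\<close>, the least element of \<open>X \<inter> A\<close> is least in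
  \<open>X\<close>.\<close>

lemma well_ordered_Union:
  assumes ch: "\<And>A B. A \<in> c \<Longrightarrow> B \<in> c \<Longrightarrow> initial A B \<or> initial B A" and w: "c \<subseteq> well_ordered"
  shows "\<Union>c \<in> well_ordered"
  unfolding well_ordered_iff
proof (intro conjI allI impI)
  show "\<Union>c \<subseteq> Field r" using w well_orderedD by blast
next
  fix X assume X: "X \<subseteq> \<Union>c \<and> X \<noteq> {}"
  then obtain A x where A: "A \<in> c" "x \<in> A" "x \<in> X" by blast
  then obtain m where m: "m \<in> X \<inter> A" "\<forall>x\<in>X\<inter>A. (m, x) \<in> r"
    using well_ordered_least[of A "X \<inter> A"] w by blast
  have "(m, y) \<in> r" if "y \<in> X" for y
  proof (cases "y \<in> A")
    case False
    have i: "initial A (\<Union>c)" using initial_Union[OF ch] A by blast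
    have "(y, m) \<notin> r" using i m False X that unfolding initial_def by blast
    moreover have "y \<in> Field r" "m \<in> Field r" using X that w well_orderedD m A by blast+
    ultimately show ?thesis using le_total by blast
  qed (use m that in blast)
  then show "\<exists>m\<in>X. \<forall>x\<in>X. (m, x) \<in> r" using m by blast
qed

lemma well_ordered_insert:
  assumes "A \<in> well_ordered" "a \<in> Field r" "\<And>x. x \<in> A \<Longrightarrow> (x, a) \<in> r"
  shows "insert a A \<in> well_ordered"
  unfolding well_ordered_iff
proof (intro conjI allI impI)
  show "insert a A \<subseteq> Field r" using assms well_orderedD by blast
next
  fix X assume X: "X \<subseteq> insert a A \<and> X \<noteq> {}"
  show "\<exists>m\<in>X. \<forall>x\<in>X. (m, x) \<in> r"
  proof (cases "X \<inter> A = {}")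
    case True then show ?thesis using X le_refl[OF assms(2)] by blast
  next
    case False
    then obtain m where "m \<in> X \<inter> A" "\<forall>x\<in>X\<inter>A. (m, x) \<in> r"
      using well_ordered_least[OF assms(1), of "X \<inter> A"] by blast
    then show ?thesis using X assms(3) by blast
  qed
qed

lemma initial_insert:
  assumes "\<And>x. x \<in> A \<Longrightarrow> lt x a"
  shows "initial A (insert a A)"
  using assms lt_le_trans lt_irrefl unfolding initial_def by blast

lemma initial_insert_cases:
  assumes "initial B (insert a A)" "\<And>x. x \<in> A \<Longrightarrow> lt x a" "A \<subseteq> Field r"
  shows "B = insert a A \<or> initial B A"
proof (cases "a \<in> B")
  case True
  then show ?thesis using assms lt_le unfolding initial_def by blast
next
  case False
  then show ?thesis using assms initial_restrict[of B "insert a A" A] unfolding initial_def by blast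
qed

text \<open>Connects end-extension with order filters, so that the comparison results for
  well-orders apply.\<close>

lemma initial_ofilter: "B \<in> well_ordered \<Longrightarrow> initial A B \<longleftrightarrow> ofilter (Restr r B) A"
  using well_ordered_Field_Restr[of B] unfolding initial_def ofilter_def under_def by auto

lemma Restr_Restr: "A \<subseteq> B \<Longrightarrow> Restr (Restr r B) A = Restr r A"
  by blast

end

section \<open>Order types of well-ordered sets as heights\<close>

locale heights = linear_rel q for q :: "'a rel" +
  fixes l :: "'o rel"
  assumes wo_l: "Well_order l"
    and well_ordered_small: "A \<in> well_ordered \<Longrightarrow> Restr q A <o l"
begin

sublocale l: linear_rel l
  using wo_l by unfold_locales (simp add: well_order_on_def)

lemma l_least: "X \<subseteq> Field l \<Longrightarrow> X \<noteq> {} \<Longrightarrow> \<exists>m\<in>X. \<forall>x\<in>X. (m, x) \<in> l"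
  using l.well_ordered_least[of "Field l" X] wo_l by (simp add: l.well_ordered_def Restr_Field)

lemma l_induct [consumes 1, case_names less]:
  assumes "a \<in> Field l" "\<And>a. a \<in> Field l \<Longrightarrow> (\<And>b. l.lt b a \<Longrightarrow> P b) \<Longrightarrow> P a"
  shows "P a"
proof (rule ccontr)
  assume "\<not> P a"
  then obtain m where m: "m \<in> {x \<in> Field l. \<not> P x}" "\<forall>x\<in>{x \<in> Field l. \<not> P x}. (m, x) \<in> l"
    using l_least[of "{x \<in> Field l. \<not> P x}"] assms(1) by blast
  have "P b" if "l.lt b m" for b
    using m that l.not_lt l.lt_Field[OF that] by blast
  then show False using assms(2) m by blast
qed

lemma underS_Restr_less:
  assumes "l.lt a b"
  shows "Restr l (underS l a) <o Restr l (underS l b)"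
proof -
  have "underS l a \<subset> underS l b"
    using assms l.lt_trans l.lt_irrefl unfolding l.underS_lt by blast
  moreover have "wo_rel l" using wo_l by (simp add: wo_rel_def)
  ultimately show ?thesis
    by (simp add: ofilter_subset_ordLess[OF wo_l, symmetric] wo_rel.underS_ofilter)
qed

text \<open>The description is proper on \<open>well_ordered\<close>: by
  \<open>well_ordered_small\<close> the order type is that of a proper initial segment of
  \<open>l\<close>, and different elements of \<open>l\<close> cut off segments of different
  types.\<close>

definition ht :: "'a set \<Rightarrow> 'o" where
  "ht A = (THE a. a \<in> Field l \<and> Restr q A =o Restr l (underS l a))"

lemma ht_unique:
  assumes "a \<in> Field l" "b \<in> Field l" "Restr l (underS l a) =o Restr l (underS l b)"
  shows "a = b"
proof (rule ccontr)
  assume "a \<noteq> b"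
  then consider "l.lt a b" | "l.lt b a" using assms l.le_total unfolding l.lt_def by blast
  then show False
    using assms(3) underS_Restr_less not_ordLess_ordIso ordIso_symmetric by cases blast+
qed

lemma ht_eqI:
  assumes "a \<in> Field l" "Restr q A =o Restr l (underS l a)"
  shows "ht A = a"
  unfolding ht_def
  by (rule the_equality) (use assms ht_unique ordIso_transitive ordIso_symmetric in blast)+

lemma
  assumes "A \<in> well_ordered"
  shows ht_Field: "ht A \<in> Field l" and ht_iso: "Restr q A =o Restr l (underS l (ht A))"
proof -
  obtain a where "a \<in> Field l" "Restr q A =o Restr l (underS l a)"
    using well_ordered_small[OF assms] ordLess_iff_ordIso_Restr[OF wo_l well_ordered_Well_order[OF assms]] by blast
  then show "ht A \<in> Field l" "Restr q A =o Restr l (underS l (ht A))" using ht_eqI by metis+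
qed

lemma ht_less:
  assumes "B \<in> well_ordered" "initial A B" "A \<noteq> B"
  shows "l.lt (ht A) (ht B)"
proof -
  have A: "A \<in> well_ordered" using assms well_ordered_ini by blast
  have AB: "A \<subseteq> B" using assms initial_subset by blast
  have wo: "Well_order (Restr q B)" using assms well_ordered_Well_order by blast
  have "Restr (Restr q B) A <o Restr (Restr q B) B"
    using ofilter_subset_ordLess[OF wo, of A B] assms AB initial_ofilter[OF assms(1)] initial_refl by blast
  then have *: "Restr q A <o Restr q B" using Restr_Restr[OF AB] by simp
  then have *: "Restr l (underS l (ht A)) <o Restr l (underS l (ht B))"
    using ht_iso[OF A] ht_iso[OF assms(1)] ordIso_ordLess_trans ordLess_ordIso_trans ordIso_symmetric by metis
  show ?thesis
  proof (rule ccontr)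
    assume "\<not> l.lt (ht A) (ht B)"
    then have "ht A = ht B \<or> l.lt (ht B) (ht A)"
      using ht_Field A assms(1) l.not_lt unfolding l.lt_def by blast
    then show False
      using * underS_Restr_less ordLess_irreflexive ordLess_transitive by metis
  qed
qed

lemma ht_mono: "B \<in> well_ordered \<Longrightarrow> initial A B \<Longrightarrow> (ht A, ht B) \<in> l"
  using ht_less ht_Field l.le_refl l.lt_le by metis

lemma initial_of_ht:
  "C \<in> well_ordered \<Longrightarrow> initial A C \<Longrightarrow> initial B C \<Longrightarrow> (ht A, ht B) \<in> l \<Longrightarrow> initial A B"
  using initial_comparable[of A C B] well_orderedD ht_less well_ordered_ini l.not_lt l.le_antisym l.lt_def initial_refl by metis

text \<open>A smaller order type embeds as a proper initial segment, which turns a height below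
  \<open>ht B\<close> into a segment of \<open>B\<close>.\<close>

lemma ht_surj:
  assumes "B \<in> well_ordered" "l.lt b (ht B)"
  obtains A where "initial A B" "A \<noteq> B" "ht A = b"
proof -
  have wo: "Well_order (Restr q B)" using assms well_ordered_Well_order by blast
  have wob: "Well_order (Restr l (underS l b))" using wo_l Well_order_Restr by blast
  have "Restr l (underS l b) <o Restr q B"
    using underS_Restr_less[OF assms(2)] ht_iso[OF assms(1)] ordLess_ordIso_trans ordIso_symmetric by blast
  then obtain a where a: "a \<in> Field (Restr q B)" "Restr l (underS l b) =o Restr (Restr q B) (underS (Restr q B) a)"
    using ordLess_iff_ordIso_Restr[OF wo wob] by blast
  let ?A = "underS (Restr q B) a"
  have aB: "a \<in> B" using a well_ordered_Field_Restr[OF assms(1)] by simp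
  have A: "?A = {x \<in> B. lt x a}" using aB by (auto simp: underS_def lt_def)
  have "initial ?A B" unfolding A using initial_below well_orderedD assms by blast
  moreover have "?A \<noteq> B" using A aB lt_irrefl by blast
  moreover have "Restr (Restr q B) ?A = Restr q ?A" by (rule Restr_Restr) (auto simp: A)
  then have "ht ?A = b" using a assms l.lt_Field ordIso_symmetric by (metis ht_eqI)
  ultimately show ?thesis using that by blast
qed

definition cut :: "'a set \<Rightarrow> 'o \<Rightarrow> 'a set" where
  "cut B b = (if l.lt b (ht B) then SOME A. initial A B \<and> ht A = b else B)"

lemma cut_ini: "B \<in> well_ordered \<Longrightarrow> initial (cut B b) B"
  unfolding cut_def using ht_surj[of B b] someI_ex[of "\<lambda>A. initial A B \<and> ht A = b"] by auto

lemma ht_cut: "B \<in> well_ordered \<Longrightarrow> (b, ht B) \<in> l \<Longrightarrow> ht (cut B b) = b"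
  unfolding cut_def using ht_surj[of B b] someI_ex[of "\<lambda>A. initial A B \<and> ht A = b"]
  by (auto simp: l.lt_def)

text \<open>The segment of height \<open>b\<close> of the union misses an element of some member
  \<open>A\<close>; by comparability it is a proper segment of \<open>A\<close>. So the heights of a
  chain are cofinal in the height of its union.\<close>

lemma ht_Union_less:
  assumes ch: "\<And>A B. A \<in> c \<Longrightarrow> B \<in> c \<Longrightarrow> initial A B \<or> initial B A" and w: "c \<subseteq> well_ordered"
    and "l.lt b (ht (\<Union>c))"
  shows "\<exists>A\<in>c. l.lt b (ht A)"
proof -
  have W: "\<Union>c \<in> well_ordered" using well_ordered_Union[OF ch w] .
  obtain B where B: "initial B (\<Union>c)" "B \<noteq> \<Union>c" "ht B = b" using ht_surj[OF W assms(3)] by blast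
  then obtain a A where a: "a \<in> A" "A \<in> c" "a \<notin> B" using initial_subset by blast
  have "initial B A" using initial_comparable[OF B(1), of A] initial_Union[OF ch a(2)] well_orderedD[OF W] a initial_subset by blast
  then show ?thesis using a w ht_less[of A B] B by blast
qed

end

section \<open>Trees of bounded well-ordered sets\<close>

locale regular_cardinal =
  fixes k :: "'a rel"
  assumes k_card: "Card_order k" and k_inf: "infinite (Field k)" and k_reg: "regularCard k"
begin

lemma k_Well: "Well_order k"
  using k_card by (simp add: card_order_on_def)

sublocale K: linear_rel k
  using k_Well by unfold_locales (simp add: well_order_on_def)

lemma k_no_max: "a \<in> Field k \<Longrightarrow> \<exists>b. K.lt a b"
  using infinite_Card_order_limit[OF k_card k_inf] unfolding K.lt_def by blast

lemma Field_k: "|Field k| \<le>o k"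
  using card_of_Field_ordIso[OF k_card] ordIso_imp_ordLeq by blast

text \<open>Regularity bounds \<open>X\<close> weakly; as \<open>k\<close> has no maximum, the bound
  can be made strict.\<close>

lemma k_sup:
  assumes "X \<subseteq> Field k" "|X| <o k"
  shows "\<exists>m\<in>Field k. \<forall>x\<in>X. K.lt x m"
proof -
  have "\<not> |X| =o k" using assms not_ordLess_ordIso by blast
  then have "\<not> cofinal X k" using k_reg assms unfolding regularCard_def by blast
  then obtain a where a: "a \<in> Field k" "\<forall>x\<in>X. \<not> K.lt a x"
    unfolding cofinal_def K.lt_def by blast
  obtain m where m: "K.lt a m" using k_no_max a by blast
  then have "K.lt x m" if "x \<in> X" for x
    using a that assms K.not_lt K.le_lt_trans by blast
  then show ?thesis using m K.lt_Field by blast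
qed

lemma underS_k_small: "a \<in> Field k \<Longrightarrow> |underS k a| <o k"
  using card_of_underS[OF k_card] .

lemma finite_small: "finite A \<Longrightarrow> |A| <o k"
  using finite_ordLess_infinite[OF card_of_Well_order k_Well, of A] k_inf by (simp add: Field_card_of)

lemma image_small: "|A| <o k \<Longrightarrow> |f ` A| <o k"
  using card_of_image ordLeq_ordLess_trans by blast

lemma image_le: "|A| \<le>o k \<Longrightarrow> |f ` A| \<le>o k"
  using card_of_image ordLeq_transitive by blast

lemma UN_le: "|I| \<le>o k \<Longrightarrow> (\<And>i. i \<in> I \<Longrightarrow> |A i| \<le>o k) \<Longrightarrow> |\<Union>i\<in>I. A i| \<le>o k"
  by (rule card_of_UNION_ordLeq_infinite_Field[OF k_inf k_card]) auto

lemma Times_le: "|A| \<le>o k \<Longrightarrow> |B| \<le>o k \<Longrightarrow> |A \<times> B| \<le>o k"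
  using card_of_Times_ordLeq_infinite_Field[OF k_inf _ _ k_card] by blast

lemma insert_small: "|A| <o k \<Longrightarrow> |insert a A| <o k"
  using card_of_Un_ordLess_infinite_Field[OF k_inf k_card, of A "{a}"] finite_small[of "{a}"] by simp

end

text \<open>\<open>q\<close> is a copy of \<open>Q_order k\<close> on the field of \<open>k\<close>,
  which makes nodes sets over \<open>'a\<close>; \<open>q0\<close> is a base point for upper bounds.
  \<open>q_interval\<close> gives the room for climbing: every interval contains \<open>k\<close>
  successive nondegenerate subintervals from \<open>p i\<close> to \<open>s i\<close>.
  \<open>seqs\<close> carries \<open>k^{<k} = k\<close>.\<close>

locale tree_setting = regular_cardinal k
  for k :: "'a rel" +
  fixes q :: "'a rel" and q0 :: 'a and C :: "'a set \<Rightarrow> 'a set set"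
  assumes q_lin: "Linear_order q" and q_Field: "Field q = Field k" and q0: "q0 \<in> Field q"
    and q_bounded: "\<And>A. A \<subseteq> Field q \<Longrightarrow> |A| <o k \<Longrightarrow> \<exists>b\<in>Field q. \<forall>a\<in>A. (a, b) \<in> q \<and> a \<noteq> b"
    and q_interval: "\<And>b b'. (b, b') \<in> q \<Longrightarrow> b \<noteq> b' \<Longrightarrow> \<exists>p s.
      (\<forall>i\<in>Field k. (b, p i) \<in> q \<and> (p i, s i) \<in> q \<and> p i \<noteq> s i \<and> (s i, b') \<in> q \<and> s i \<noteq> b') \<and>
      (\<forall>i j. (i, j) \<in> k \<and> i \<noteq> j \<longrightarrow> (s i, p j) \<in> q)"
    and C_unbounded: "\<And>d. d \<in> Field (cardSuc k) \<Longrightarrow> unbounded_in (cardSuc k) (underS (cardSuc k) d) (C d)"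
    and C_type: "\<And>d. d \<in> Field (cardSuc k) \<Longrightarrow> Restr (cardSuc k) (C d) \<le>o k"
    and seqs: "\<And>a. a \<in> Field k \<Longrightarrow> |Func (underS k a) (Field k)| \<le>o k"
begin

abbreviation "l \<equiv> cardSuc k"

sublocale linear_rel q
  by unfold_locales (rule q_lin)

lemma l_card: "Card_order l"
  using k_card by (rule cardSuc_Card_order)

lemma less_l: "|A| <o l \<longleftrightarrow> |A| \<le>o k"
  using cardSuc_ordLeq_ordLess[OF k_card card_of_Card_order] .

text \<open>A subset of the field of \<open>q\<close> has at most \<open>k\<close> elements, so its
  order type is below the successor cardinal.\<close>

sublocale heights q "cardSuc k"
proof unfold_locales
  show "Well_order l" using l_card by (simp add: card_order_on_def)
next
  fix A assume A: "A \<in> well_ordered"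
  have "|A| \<le>o |Field k|" using well_orderedD[OF A] q_Field by (simp add: card_of_mono1)
  then have "|A| \<le>o k" using card_of_Field_ordIso[OF k_card] ordLeq_ordIso_trans by blast
  then have "|A| <o l" by (simp add: less_l)
  moreover have "l =o |Field l|" using card_of_Field_ordIso[OF l_card] ordIso_symmetric by blast
  moreover have "|Field l| \<le>o |A|" if "l \<le>o Restr q A"
    using card_of_mono2[OF that] well_ordered_Field_Restr[OF A] by simp
  ultimately have "\<not> l \<le>o Restr q A"
    using not_ordLess_ordLeq ordIso_ordLeq_trans by blast
  then show "Restr q A <o l"
    using well_ordered_Well_order[OF A] l_card not_ordLeq_iff_ordLess by (auto simp: card_order_on_def)
qed

lemma l_inf: "infinite (Field l)"
  using k_inf k_card by (simp add: cardSuc_finite)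

lemma l_no_max: "a \<in> Field l \<Longrightarrow> \<exists>b. l.lt a b"
  using infinite_Card_order_limit[OF l_card l_inf] unfolding l.lt_def by blast

lemma Field_l: "|Field l| \<le>o l"
  using card_of_Field_ordIso[OF l_card] ordIso_imp_ordLeq by blast

lemma l_sup:
  assumes "X \<subseteq> Field l" "|X| \<le>o k"
  shows "\<exists>m\<in>Field l. \<forall>x\<in>X. l.lt x m"
proof -
  have reg: "regularCard l" using infinite_cardSuc_regularCard[OF _ k_card] k_inf by blast
  have "|X| <o l" using assms less_l by blast
  then have "\<not> |X| =o l" using not_ordLess_ordIso by blast
  then have "\<not> cofinal X l" using reg assms unfolding regularCard_def by blast
  then obtain a where a: "a \<in> Field l" "\<forall>x\<in>X. \<not> l.lt a x"
    unfolding cofinal_def l.lt_def by blast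
  obtain m where m: "l.lt a m" using l_no_max a by blast
  then have "l.lt x m" if "x \<in> X" for x
    using a that assms l.not_lt l.le_lt_trans by blast
  then show ?thesis using m l.lt_Field by blast
qed

lemma underS_l_small: "a \<in> Field l \<Longrightarrow> |underS l a| \<le>o k"
  using card_of_underS[OF l_card] less_l by blast

section \<open>The sets \<open>C d\<close> and the cofinality of the levels\<close>

lemma C_lt: "d \<in> Field l \<Longrightarrow> c \<in> C d \<Longrightarrow> l.lt c d"
  using C_unbounded unfolding unbounded_in_def l.underS_lt by blast

lemma C_above: "l.lt b d \<Longrightarrow> \<exists>c\<in>C d. (b, c) \<in> l"
  using C_unbounded[of d] l.lt_Field unfolding unbounded_in_def l.underS_lt by blast

text \<open>The levels at which only chosen branches are extended; they have cofinality \<open>\<kappa>\<close>.\<close>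
definition branching :: "'a set set" where
  "branching = {d \<in> Field l. Restr l (C d) =o k}"

text \<open>Zero satisfies this vacuously, unlike \<open>limit_ordinal\<close>.\<close>

definition limit_ht :: "'a set \<Rightarrow> bool" where
  "limit_ht d \<longleftrightarrow> (\<forall>b. l.lt b d \<longrightarrow> (\<exists>b'. l.lt b b' \<and> l.lt b' d))"

lemma C_Field: "d \<in> Field l \<Longrightarrow> C d \<subseteq> Field l"
  using C_lt l.lt_Field by blast

lemma C_well_ordered: "d \<in> Field l \<Longrightarrow> C d \<in> l.well_ordered"
  using C_Field l_least unfolding l.well_ordered_iff by (meson subset_trans)

text \<open>\<open>e c\<close> plays the part of the position of \<open>c\<close> in
  \<open>C d\<close>. Since it is an element of \<open>k\<close>, fewer than \<open>k\<close>
  elements of \<open>C d\<close> lie below \<open>c\<close>.\<close>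

lemma C_rank:
  assumes "d \<in> Field l"
  obtains e where "\<And>c. c \<in> C d \<Longrightarrow> e c \<in> Field k" "\<And>c c'. c \<in> C d \<Longrightarrow> c' \<in> C d \<Longrightarrow> l.lt c c' \<Longrightarrow> K.lt (e c) (e c')"
proof -
  let ?r = "Restr l (C d)"
  have F: "Field ?r = C d" using l.well_ordered_Field_Restr[OF C_well_ordered[OF assms]] .
  obtain e where e: "embed ?r k e" using C_type[OF assms] unfolding ordLeq_def by blast
  have wo: "Well_order ?r" using l.well_ordered_Well_order[OF C_well_ordered[OF assms]] .
  have "compat ?r k e" "inj_on e (C d)" "e ` C d \<subseteq> Field k"
    using embed_compat[OF e] embed_inj_on[OF wo e] embed_Field[OF e] F by auto
  then show ?thesis
    using that[of e] C_Field[OF assms] unfolding compat_def l.lt_def K.lt_def inj_on_def by blast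
qed

text \<open>Moving each \<open>x\<close> up into \<open>C d\<close> and on to \<open>k\<close> by
  the isomorphism gives fewer than \<open>k\<close> elements of \<open>k\<close>. By regularity they
  have a bound \<open>m\<close>, and then no \<open>x\<close> reaches the element of
  \<open>C d\<close> that corresponds to \<open>m\<close>.\<close>

lemma branching_cof:
  assumes "d \<in> branching" "|X| <o k" "\<And>x. x \<in> X \<Longrightarrow> l.lt x d" "\<And>b. l.lt b d \<Longrightarrow> \<exists>x\<in>X. (b, x) \<in> l"
  shows False
proof -
  have d: "d \<in> Field l" "Restr l (C d) =o k" using assms by (auto simp: branching_def)
  then obtain f where f: "iso (Restr l (C d)) k f" unfolding ordIso_def by blast
  have F: "Field (Restr l (C d)) = C d" using l.well_ordered_Field_Restr[OF C_well_ordered[OF d(1)]] .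
  have bij: "bij_betw f (C d) (Field k)"
    using f F l.well_ordered_Well_order[OF C_well_ordered[OF d(1)]] k_Well iso_iff2 by metis
  have mono: "(f a, f b) \<in> k" if "a \<in> C d" "b \<in> C d" "(a, b) \<in> l" for a b
    using f F l.well_ordered_Well_order[OF C_well_ordered[OF d(1)]] k_Well iso_iff2[of "Restr l (C d)" k f] that by auto
  define g where "g x = (SOME c. c \<in> C d \<and> (x, c) \<in> l)" for x
  have g: "g x \<in> C d \<and> (x, g x) \<in> l" if "x \<in> X" for x
    unfolding g_def by (rule someI_ex) (use C_above assms(3)[OF that] in blast)
  have "f ` g ` X \<subseteq> Field k" using g bij by (auto simp: bij_betw_def)
  moreover have "|f ` g ` X| <o k" using assms(2) by (intro image_small)
  ultimately obtain m where m: "m \<in> Field k" "\<forall>y\<in>f ` g ` X. K.lt y m"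
    using k_sup[of "f ` g ` X"] by blast
  have "m \<in> f ` C d" using bij m(1) by (simp add: bij_betw_def)
  then obtain c where c: "c \<in> C d" "f c = m" by (rule imageE) simp
  obtain x where x: "x \<in> X" "(c, x) \<in> l" using assms(4)[OF C_lt[OF d(1) c(1)]] by blast
  then have "(c, g x) \<in> l" using g l.le_trans by blast
  then have "(m, f (g x)) \<in> k" using mono[of c "g x"] c g x by blast
  then show False using m x K.le_lt_trans K.lt_irrefl by blast
qed

lemma branching_lim: "d \<in> branching \<Longrightarrow> limit_ht d"
proof (rule ccontr)
  assume d: "d \<in> branching" "\<not> limit_ht d"
  then obtain b where b: "l.lt b d" "\<And>b'. l.lt b' d \<Longrightarrow> \<not> l.lt b b'" unfolding limit_ht_def by blast
  then have *: "(b', b) \<in> l" if "l.lt b' d" for b'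
    using l.not_lt[of b b'] that l.lt_Field by blast
  show False
    by (rule branching_cof[OF d(1), of "{b}"]) (use b * finite_small[of "{b}"] in auto)
qed

lemma branching_pos:
  assumes "d \<in> branching" shows "\<exists>b. l.lt b d"
proof (rule ccontr)
  assume "\<nexists>b. l.lt b d"
  then show False
    by (intro branching_cof[OF assms, of "{}"]) (use finite_small in auto)
qed

text \<open>Well-ordering \<open>S\<close> in a type \<open>a\<close> below \<open>k\<close> turns
  functions on \<open>S\<close> into sequences of length \<open>a\<close>, which \<open>seqs\<close>
  counts.\<close>

lemma small_Func:
  assumes "|S| <o k" "|X| \<le>o k"
  shows "|Func S X| \<le>o k"
proof -
  obtain a where a: "a \<in> Field k" "|S| =o Restr k (underS k a)"
    using ordLess_iff_ordIso_Restr[OF k_Well card_of_Well_order] assms(1) by blast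
  have F: "Field (Restr k (underS k a)) = underS k a"
    by (rule Refl_Field_Restr2) (use k_Well in \<open>auto simp: order_on_defs underS_def Field_def\<close>)
  have S: "|S| =o |underS k a|" using card_of_cong[OF a(2)] by (simp add: F Field_card_of)
  have "|X| ^c |S| \<le>o |Field k| ^c |underS k a|"
  proof (rule cexp_mono')
    show "|X| \<le>o |Field k|"
      using assms(2) card_of_Field_ordIso[OF k_card] ordIso_symmetric ordLeq_ordIso_trans by blast
    show "|S| \<le>o |underS k a|" using S ordIso_imp_ordLeq by blast
    \<comment> \<open>Exponentiation is monotone in the exponent only under this condition, since
      \<open>0 ^ 0 = 1\<close> exceeds \<open>0 ^ n\<close> for nonzero \<open>n\<close>.\<close>
    show "Field |S| = {} \<Longrightarrow> Field |underS k a| = {}"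
    proof -
      assume "Field |S| = {}"
      then have "|underS k a| =o |{} :: 'b set|" using S ordIso_symmetric by (simp add: Field_card_of)
      then show ?thesis using card_of_empty2 by (simp add: Field_card_of)
    qed
  qed
  then have "|Func S X| \<le>o |Func (underS k a) (Field k)|" by (simp add: cexp_def Field_card_of)
  then show ?thesis using seqs[OF a(1)] ordLeq_transitive by blast
qed

text \<open>With \<open>q0\<close> included, \<open>b\<close> lies in the field even for empty
  \<open>A\<close>, and the cut generated by a node is never empty.\<close>

definition bounded_by :: "'a set \<Rightarrow> 'a \<Rightarrow> bool" where
  "bounded_by A b \<longleftrightarrow> (\<forall>x\<in>insert q0 A. (x, b) \<in> q)"

text \<open>Makes the supremum in the Dedekind completion increase strictly along end-extensions.\<close>
definition gapped :: "'a set \<Rightarrow> bool" where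
  "gapped A \<longleftrightarrow> (\<forall>a\<in>A. \<exists>c. lt c a \<and> bounded_by {x \<in> A. lt x a} c)"

text \<open>\<open>P d\<close> stands for the branches that receive a node on level
  \<open>d\<close>; it is consulted only on the levels in \<open>branching\<close>.\<close>

definition nodes :: "('a set \<Rightarrow> 'a set set) \<Rightarrow> 'a set set" where
  "nodes P = {A \<in> well_ordered. (\<exists>b. bounded_by A b) \<and> gapped A \<and> (\<forall>B. initial B A \<and> ht B \<in> branching \<longrightarrow> B \<in> P (ht B))}"

definition nodes_below :: "('a set \<Rightarrow> 'a set set) \<Rightarrow> 'a set \<Rightarrow> 'a set set" where
  "nodes_below P d = {A \<in> nodes P. l.lt (ht A) d}"

text \<open>Density of \<open>E\<close> among the nodes of height below \<open>c\<close>, with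
  control of upper bounds: meeting \<open>E\<close> uses up only an arbitrarily small part of the
  space above \<open>w\<close>.\<close>

definition reachable :: "('a set \<Rightarrow> bool) \<Rightarrow> 'a set set \<Rightarrow> 'a set \<Rightarrow> bool" where
  "reachable E X c \<longleftrightarrow> (\<forall>w\<in>X. l.lt (ht w) c \<longrightarrow> (\<forall>b b'. bounded_by w b \<and> lt b b' \<longrightarrow>
    (\<exists>z\<in>X. l.lt (ht z) c \<and> initial w z \<and> bounded_by z b' \<and> E z)))"

text \<open>Describes the branches that qualify for a node on level \<open>d\<close>. Demands that
  are not reachable are waived, so that the construction works for every \<open>D\<close>.\<close>

definition good_branch ::
    "('a set \<Rightarrow> 'a \<Rightarrow> 'a set \<Rightarrow> 'a set \<Rightarrow> bool) \<Rightarrow> 'a set set \<Rightarrow> 'a set \<Rightarrow> 'a set \<Rightarrow> 'a \<Rightarrow> 'a \<Rightarrow> 'a set \<Rightarrow> bool" where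
  "good_branch D X d x b \<xi> A \<longleftrightarrow> A \<in> well_ordered \<and> ht A = d \<and> initial x A \<and> bounded_by A b \<and>
    (\<forall>B. initial B A \<and> B \<noteq> A \<longrightarrow> B \<in> X) \<and>
    (\<forall>c\<in>C d - limit_points l (C d). l.lt (ht x) c \<and> reachable (D d \<xi> c) X c \<longrightarrow>
      (\<exists>z. initial z A \<and> z \<noteq> A \<and> D d \<xi> c z))"

text \<open>One branch for each triple keeps the level small. Varying \<open>x\<close> and
  \<open>b\<close> lets every lower node be extended to level \<open>d\<close> below prescribed
  bounds, and varying \<open>\<xi>\<close> leaves room for \<open>k\<close> guesses.\<close>

definition chosen :: "('a set \<Rightarrow> 'a \<Rightarrow> 'a set \<Rightarrow> 'a set \<Rightarrow> bool) \<Rightarrow> 'a set set \<Rightarrow> 'a set \<Rightarrow> 'a set set" where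
  "chosen D X d = (\<lambda>(x, b, \<xi>). SOME A. good_branch D X d x b \<xi> A) `
    {(x, b, \<xi>). x \<in> X \<and> b \<in> Field q \<and> \<xi> \<in> Field k \<and> (\<exists>A. good_branch D X d x b \<xi> A)}"

text \<open>Well-founded recursion on the level: a node of height below \<open>d\<close> refers to
  \<open>P\<close> only at heights below \<open>d\<close>.\<close>

lemma ex_chosen: "\<exists>P. \<forall>d. P d = chosen D (nodes_below P d) d"
proof (rule dependent_wf_choice)
  show "wf (l - Id)" using wo_l by (simp add: well_order_on_def)
  show "(r = chosen D (nodes_below f d) d) = (r = chosen D (nodes_below g d) d)"
    if "\<And>z. (z, d) \<in> l - Id \<Longrightarrow> f z = g z" for f g d r
  proof -
    have eq: "f z = g z" if "l.lt z d" for z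
      using that \<open>\<And>z. (z, d) \<in> l - Id \<Longrightarrow> f z = g z\<close> by (simp add: l.lt_def)
    have "f (ht B) = g (ht B)" if "A \<in> well_ordered" "l.lt (ht A) d" "initial B A" for A B
      using eq l.le_lt_trans that ht_mono by blast
    then have "nodes_below f d = nodes_below g d"
      unfolding nodes_below_def nodes_def by blast
    then show ?thesis by simp
  qed
qed blast

end

text \<open>
  \<open>D d \<xi> c z\<close> says that \<open>z\<close> is a step that the \<open>\<xi>\<close>-th branch of level \<open>d\<close> should take at \<open>c \<in> C d\<close>.
\<close>
locale tree_family = tree_setting +
  fixes D :: "'a set \<Rightarrow> 'a \<Rightarrow> 'a set \<Rightarrow> 'a set \<Rightarrow> bool" and P :: "'a set \<Rightarrow> 'a set set"
  assumes P_eq: "P d = chosen D (nodes_below P d) d"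
begin

section \<open>Closure properties of the set of nodes\<close>

abbreviation "T \<equiv> nodes P"

lemma T_well_ordered: "A \<in> T \<Longrightarrow> A \<in> well_ordered"
  by (simp add: nodes_def)

lemma bounded_by_mono: "bounded_by A b \<Longrightarrow> B \<subseteq> A \<Longrightarrow> (b, b') \<in> q \<Longrightarrow> bounded_by B b'"
  unfolding bounded_by_def using le_trans by blast

lemma bounded_by_subset: "bounded_by A b \<Longrightarrow> B \<subseteq> A \<Longrightarrow> bounded_by B b"
  unfolding bounded_by_def by blast

lemma bounded_by_lt: "bounded_by A b \<Longrightarrow> lt b b' \<Longrightarrow> bounded_by A b'"
  using bounded_by_mono lt_le by blast

lemma gapped_subset: "gapped A \<Longrightarrow> B \<subseteq> A \<Longrightarrow> gapped B"
  unfolding gapped_def using bounded_by_subset by (metis (no_types, lifting) Collect_mono subset_iff)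

lemma T_ini: "A \<in> T \<Longrightarrow> initial B A \<Longrightarrow> B \<in> T"
  unfolding nodes_def
  using well_ordered_ini[of A B] bounded_by_subset[of A _ B] gapped_subset[of A B] initial_subset[of B A] initial_trans[of _ B A]
  by blast

lemma T_I:
  assumes "A \<in> well_ordered" "bounded_by A b" "gapped A" "\<And>B. initial B A \<Longrightarrow> B \<noteq> A \<Longrightarrow> B \<in> T" "ht A \<in> branching \<Longrightarrow> A \<in> P (ht A)"
  shows "A \<in> T"
  using assms(1-3,5) assms(4) unfolding nodes_def by (auto intro: initial_refl)

lemma T_bd: "A \<in> T \<Longrightarrow> \<exists>b. bounded_by A b"
  by (simp add: nodes_def)

lemma bounded_by_above: "bounded_by A b \<Longrightarrow> \<exists>b'. lt b b'"
proof -
  assume "bounded_by A b"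
  then have "{b} \<subseteq> Field q" using le_Field unfolding bounded_by_def by blast
  then show ?thesis using q_bounded[of "{b}"] finite_small[of "{b}"] unfolding lt_def by auto
qed

lemma T_empty: "{} \<in> T"
proof (rule T_I)
  show "bounded_by {} q0" using q0 le_refl by (simp add: bounded_by_def)
  show "{} \<in> P (ht {})" if "ht {} \<in> branching"
    using branching_pos[OF that] ht_surj[OF well_ordered_empty] initial_subset by (metis subset_empty)
  show "B \<in> T" if "initial B {}" "B \<noteq> {}" for B using that initial_subset by blast
qed (auto simp: gapped_def)

lemma dense: "lt b b' \<Longrightarrow> \<exists>m. lt b m \<and> lt m b'"
proof -
  assume "lt b b'"
  then obtain p s where "\<forall>i\<in>Field k. (b, p i) \<in> q \<and> (p i, s i) \<in> q \<and> p i \<noteq> s i \<and> (s i, b') \<in> q \<and> s i \<noteq> b'"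
    using q_interval[of b b'] unfolding lt_def by blast
  moreover obtain i where "i \<in> Field k" using k_inf by fastforce
  ultimately have "lt b (s i) \<and> lt (s i) b'" using le_lt_trans unfolding lt_def by blast
  then show ?thesis by blast
qed

text \<open>Together the two claims make the height of \<open>insert a A\<close> the successor of
  the height of \<open>A\<close>.\<close>

lemma ht_insert:
  assumes "A \<in> well_ordered" "\<And>x. x \<in> A \<Longrightarrow> lt x a" "a \<in> Field q"
  shows "l.lt (ht A) (ht (insert a A))" "l.lt b (ht (insert a A)) \<Longrightarrow> (b, ht A) \<in> l"
proof -
  have w: "insert a A \<in> well_ordered" using well_ordered_insert assms lt_le by blast
  have "a \<notin> A" using assms lt_irrefl by blast
  then show "l.lt (ht A) (ht (insert a A))" using ht_less[OF w initial_insert] assms by blast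
  assume "l.lt b (ht (insert a A))"
  then obtain B where B: "initial B (insert a A)" "B \<noteq> insert a A" "ht B = b" using ht_surj[OF w] by blast
  then have "initial B A" using initial_insert_cases[OF B(1)] assms well_orderedD by blast
  then show "(b, ht A) \<in> l" using ht_mono assms B by blast
qed

lemma T_insert:
  assumes A: "A \<in> T" and b: "bounded_by A b" "lt b a"
  shows "insert a A \<in> T" "bounded_by (insert a A) a" "initial A (insert a A)" "a \<notin> A"
    "l.lt (ht A) (ht (insert a A))" "\<And>b. l.lt b (ht (insert a A)) \<Longrightarrow> (b, ht A) \<in> l"
proof -
  have lt: "lt x a" if "x \<in> A" for x using b that le_lt_trans unfolding bounded_by_def by blast
  have a: "a \<in> Field q" using b lt_Field by blast
  show bda: "bounded_by (insert a A) a" using bounded_by_lt[OF b] le_refl[OF a] unfolding bounded_by_def by blast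
  show "initial A (insert a A)" using initial_insert lt by blast
  show "a \<notin> A" using lt lt_irrefl by blast
  note h = ht_insert[OF T_well_ordered[OF A] lt a]
  show 1: "l.lt (ht A) (ht (insert a A))" using h(1) .
  show 2: "\<And>b. l.lt b (ht (insert a A)) \<Longrightarrow> (b, ht A) \<in> l" using h(2) .
  show "insert a A \<in> T"
  proof (rule T_I[OF _ bda])
    show "insert a A \<in> well_ordered" using well_ordered_insert T_well_ordered[OF A] a lt lt_le by blast
    show "gapped (insert a A)" unfolding gapped_def
    proof
      fix y assume "y \<in> insert a A"
      then consider "y = a" | "y \<in> A" by blast
      then show "\<exists>c. lt c y \<and> bounded_by {x \<in> insert a A. lt x y} c"
      proof cases
        \<comment> \<open>The new top element is separated from \<open>A\<close> by
          \<open>b\<close>.\<close>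
        case 1
        then have "{x \<in> insert a A. lt x y} \<subseteq> A" using lt_irrefl by blast
        then show ?thesis using b 1 bounded_by_subset by blast
      next
        case 2
        then obtain c where c: "lt c y" "bounded_by {x \<in> A. lt x y} c" using A unfolding nodes_def gapped_def by blast
        have "\<not> lt a y" using lt[OF 2] lt_trans lt_irrefl by blast
        then have "{x \<in> insert a A. lt x y} = {x \<in> A. lt x y}" by blast
        then show ?thesis using c by auto
      qed
    qed
    show "B \<in> T" if "initial B (insert a A)" "B \<noteq> insert a A" for B
      using initial_insert_cases[OF that(1) lt] that(2) well_orderedD T_well_ordered[OF A] T_ini[OF A] by blast
    \<comment> \<open>A successor height is never in \<open>branching\<close>, whose elements are
      limits.\<close>
    show "insert a A \<in> P (ht (insert a A))" if "ht (insert a A) \<in> branching"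
      using branching_lim[OF that] 1 2 l.le_lt_trans l.lt_irrefl unfolding limit_ht_def by blast
  qed
qed

text \<open>The elements below \<open>a\<close> form a segment of smaller height than
  \<open>A\<close>. At a limit there is a longer segment that is still proper, and it contains
  \<open>a\<close>.\<close>

lemma mem_proper:
  assumes A: "A \<in> well_ordered" and "limit_ht (ht A)" and a: "a \<in> A"
  obtains B where "initial B A" "B \<noteq> A" "a \<in> B"
proof -
  let ?S = "{x \<in> A. lt x a}"
  have S: "initial ?S A" using initial_below well_orderedD[OF A] by blast
  have "?S \<noteq> A" using a lt_irrefl by blast
  then have "l.lt (ht ?S) (ht A)" using ht_less[OF A S] by blast
  then obtain b where b: "l.lt (ht ?S) b" "l.lt b (ht A)" using assms(2) unfolding limit_ht_def by blast
  then obtain B where B: "initial B A" "B \<noteq> A" "ht B = b" using ht_surj[OF A] by blast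
  have "\<not> B \<subseteq> ?S"
  proof
    assume "B \<subseteq> ?S"
    then have "initial B ?S" using B initial_restrict by blast
    then have "(ht B, ht ?S) \<in> l" using ht_mono well_ordered_ini[OF A S] by blast
    then show False using b B l.le_lt_trans l.lt_irrefl by blast
  qed
  then obtain y where y: "y \<in> B" "\<not> lt y a" using initial_subset[OF B(1)] by blast
  then have "(a, y) \<in> q" using not_lt[of y a] well_orderedD[OF A] a initial_subset[OF B(1)] by blast
  then have "a \<in> B" using B y a unfolding initial_def by blast
  then show ?thesis using that B by blast
qed

text \<open>Being gapped concerns each element and what lies below it, so at a limit it is inherited
  from the proper segments.\<close>

lemma T_limit:
  assumes A: "A \<in> well_ordered" and l: "limit_ht (ht A)" and b: "bounded_by A b"
    and p: "\<And>B. initial B A \<Longrightarrow> B \<noteq> A \<Longrightarrow> B \<in> T" and "ht A \<in> branching \<Longrightarrow> A \<in> P (ht A)"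
  shows "A \<in> T"
proof (rule T_I[OF A b _ p])
  show "gapped A" unfolding gapped_def
  proof
    fix a assume a: "a \<in> A"
    obtain B where B: "initial B A" "B \<noteq> A" "a \<in> B" using mem_proper[OF A l a] by blast
    then have "gapped B" using p by (simp add: nodes_def)
    then obtain c where c: "lt c a" "bounded_by {x \<in> B. lt x a} c" using B unfolding gapped_def by blast
    have "{x \<in> A. lt x a} \<subseteq> {x \<in> B. lt x a}" using B lt_le unfolding initial_def by blast
    then show "\<exists>c. lt c a \<and> bounded_by {x \<in> A. lt x a} c" using c bounded_by_subset by blast
  qed
qed (use assms in auto)

text \<open>Without a last member, the height of the union is a limit of fewer than \<open>k\<close>
  smaller heights. By \<open>branching_cof\<close> it is not in \<open>branching\<close>, so
  membership in \<open>P\<close> is not asked for.\<close>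

lemma T_Union:
  assumes c: "c \<subseteq> T" "c \<noteq> {}" "|c| <o k" and ch: "\<And>A B. A \<in> c \<Longrightarrow> B \<in> c \<Longrightarrow> initial A B \<or> initial B A"
  shows "\<Union>c \<in> T"
proof (cases "\<Union>c \<in> c")
  case False
  have cw: "c \<subseteq> well_ordered" using c T_well_ordered by blast
  have W: "\<Union>c \<in> well_ordered" using well_ordered_Union[OF ch cw] .
  have i: "initial A (\<Union>c)" if "A \<in> c" for A using initial_Union[OF ch that] .
  have less: "l.lt (ht A) (ht (\<Union>c))" if "A \<in> c" for A
    using ht_less[OF W i[OF that]] that False by auto
  have cof: "\<exists>A\<in>c. l.lt b (ht A)" if "l.lt b (ht (\<Union>c))" for b
    using ht_Union_less[OF ch cw that] .
  have "limit_ht (ht (\<Union>c))" unfolding limit_ht_def using cof less by blast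
  moreover have "ht (\<Union>c) \<notin> branching"
  proof
    assume "ht (\<Union>c) \<in> branching"
    then show False
      by (rule branching_cof[of _ "ht ` c"]) (use image_small c less cof l.lt_le in \<open>auto, blast?\<close>)
  qed
  moreover have "\<exists>b. bounded_by (\<Union>c) b"
  proof -
    \<comment> \<open>The points \<open>y A\<close> beyond \<open>A\<close> are cofinal in the
      union, and being fewer than \<open>k\<close> they have an upper bound in
      \<open>q\<close>.\<close>
    have "\<exists>y. y \<in> \<Union>c - A" if "A \<in> c" for A
    proof (rule ccontr)
      assume "\<not> ?thesis"
      then have "\<Union>c = A" using that by (intro equalityI) blast+
      then show False using False that by simp
    qed
    then obtain y where y: "\<And>A. A \<in> c \<Longrightarrow> y A \<in> \<Union>c - A" by metis
    have "insert q0 (y ` c) \<subseteq> Field q" using q0 y well_orderedD[OF W] by blast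
    moreover have "|insert q0 (y ` c)| <o k" using c(3) by (intro insert_small image_small)
    ultimately obtain b where b: "\<forall>a\<in>insert q0 (y ` c). (a, b) \<in> q \<and> a \<noteq> b"
      using q_bounded by blast
    have "(x, b) \<in> q" if x: "x \<in> \<Union>c" for x
    proof -
      obtain A where A: "A \<in> c" "x \<in> A" using x by blast
      have "(y A, x) \<notin> q" using A y[of A] i[OF A(1)] unfolding initial_def by blast
      then have "(x, y A) \<in> q" using le_total[of x "y A"] y[of A] A x well_orderedD[OF W] by blast
      then show ?thesis using b A le_trans by blast
    qed
    then show ?thesis using b unfolding bounded_by_def by blast
  qed
  moreover have "B \<in> T" if B: "initial B (\<Union>c)" "B \<noteq> \<Union>c" for B
  proof -
    obtain A where A: "A \<in> c" "l.lt (ht B) (ht A)" using cof ht_less[OF W B] by blast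
    then have "initial B A" using initial_of_ht[OF W B(1) i[OF A(1)]] l.lt_le by blast
    then show ?thesis using T_ini A c by blast
  qed
  ultimately show ?thesis using T_limit[OF W] by blast
qed (use c in blast)

text \<open>The proper segments of a good branch are nodes and its height is a limit, so being
  chosen is the last condition that \<open>T_limit\<close> asks for.\<close>

lemma branching_P: "d \<in> branching \<Longrightarrow> A \<in> P d \<Longrightarrow> A \<in> T \<and> ht A = d"
proof -
  assume d: "d \<in> branching" "A \<in> P d"
  then obtain x b \<xi> where "A = (SOME A. good_branch D (nodes_below P d) d x b \<xi> A)"
    "\<exists>A. good_branch D (nodes_below P d) d x b \<xi> A"
    using P_eq[of d] unfolding chosen_def by auto
  then have g: "good_branch D (nodes_below P d) d x b \<xi> A"
    using someI_ex[of "good_branch D (nodes_below P d) d x b \<xi>"] by simp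
  then have "A \<in> T"
    using T_limit[of A b] branching_lim d unfolding good_branch_def nodes_below_def by blast
  then show ?thesis using g unfolding good_branch_def by blast
qed

end

section \<open>Extending branches\<close>

context tree_family
begin

text \<open>The induction statement for levels. Control of the bound \<open>b'\<close> is part of it
  because a limit construction must keep room for all its later steps.\<close>

definition extendible :: "'a set \<Rightarrow> bool" where
  "extendible g \<longleftrightarrow> (\<forall>A\<in>T. (ht A, g) \<in> l \<longrightarrow> (\<forall>b b'. bounded_by A b \<and> lt b b' \<longrightarrow>
    (\<exists>B\<in>T. ht B = g \<and> initial A B \<and> bounded_by B b')))"

lemma reachable_below:
  assumes "(c, d) \<in> l" "reachable E (nodes_below P d) c" "w \<in> T" "l.lt (ht w) c" "bounded_by w b" "lt b b'"
  shows "\<exists>z\<in>T. l.lt (ht z) c \<and> initial w z \<and> bounded_by z b' \<and> E z"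
  using assms l.lt_le_trans[OF assms(4,1)] unfolding reachable_def nodes_below_def by blast

text \<open>Climb from \<open>x\<close> along \<open>C d\<close>: the node for \<open>c\<close> has
  height \<open>c\<close> and stays below \<open>s (e c)\<close>, where \<open>e c\<close> is the
  position of \<open>c\<close>. The later subintervals lie above this point, so there is room for
  all steps, and all of them stay below \<open>b'\<close>.\<close>

lemma branch_ex:
  assumes d: "d \<in> Field l" "limit_ht d" and ext: "\<And>g. l.lt g d \<Longrightarrow> extendible g"
    and x: "x \<in> T" "l.lt (ht x) d" "bounded_by x b" "lt b b'"
  shows "\<exists>A. good_branch D (nodes_below P d) d x b' \<xi> A"
proof -
  define Cx where "Cx = {c \<in> C d. l.lt (ht x) c}"
  obtain e where e: "\<And>c. c \<in> C d \<Longrightarrow> e c \<in> Field k"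
      "\<And>c c'. c \<in> C d \<Longrightarrow> c' \<in> C d \<Longrightarrow> l.lt c c' \<Longrightarrow> K.lt (e c) (e c')"
    using C_rank[OF d(1)] by blast
  obtain p s where ps: "\<And>i. i \<in> Field k \<Longrightarrow> (b, p i) \<in> q \<and> lt (p i) (s i) \<and> (s i, b') \<in> q"
      "\<And>i j. K.lt i j \<Longrightarrow> (s i, p j) \<in> q"
    using q_interval[of b b'] x(4) unfolding lt_def K.lt_def by metis
  have Cx: "c \<in> C d" "l.lt (ht x) c" "l.lt c d" if "c \<in> Cx" for c
    using that C_lt[OF d(1)] by (auto simp: Cx_def)
  \<comment> \<open>\<open>f c\<close> is to be a node on level \<open>c\<close> above all earlier
    ones, passing through a witness for the demand at \<open>c\<close> if this demand has to be
    met.\<close>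
  define \<Phi> where "\<Phi> f c v \<longleftrightarrow> (c \<in> Cx \<longrightarrow>
      v \<in> T \<and> ht v = c \<and> initial x v \<and> (\<forall>c'\<in>Cx. l.lt c' c \<longrightarrow> initial (f c') v) \<and> bounded_by v (s (e c)) \<and>
      (c \<notin> limit_points l (C d) \<and> reachable (D d \<xi> c) (nodes_below P d) c \<longrightarrow>
        (\<exists>z. initial z v \<and> l.lt (ht z) c \<and> D d \<xi> c z)))" for f c v
  have "\<exists>f. \<forall>c. \<Phi> f c (f c)"
  proof (rule dependent_wf_choice)
    show "wf (l - Id)" using wo_l by (simp add: well_order_on_def)
    show "\<Phi> f c r = \<Phi> g c r" if "\<And>z. (z, c) \<in> l - Id \<Longrightarrow> f z = g z" for f g c r
    proof -
      have "f z = g z" if "l.lt z c" for z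
        using that \<open>\<And>z. (z, c) \<in> l - Id \<Longrightarrow> f z = g z\<close> by (simp add: l.lt_def)
      then show ?thesis unfolding \<Phi>_def by auto
    qed
    show "\<exists>v. \<Phi> f c v" if IH0: "\<And>y. (y, c) \<in> l - Id \<Longrightarrow> \<Phi> f y (f y)" for f c
    proof (cases "c \<in> Cx")
      case c: True
      have IH: "\<Phi> f y (f y)" if "l.lt y c" for y using IH0 that by (simp add: l.lt_def)
      define Z where "Z = {c' \<in> Cx. l.lt c' c}"
      have Z: "c' \<in> Cx" "l.lt c' c" "f c' \<in> T" "ht (f c') = c'" "initial x (f c')" "bounded_by (f c') (s (e c'))"
        "\<And>c''. c'' \<in> Cx \<Longrightarrow> l.lt c'' c' \<Longrightarrow> initial (f c'') (f c')" if "c' \<in> Z" for c'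
        using IH[of c'] that unfolding \<Phi>_def Z_def by auto
      define F where "F = insert x (f ` Z)"
      have Zch: "initial (f c1) (f c2) \<or> initial (f c2) (f c1)" if c12: "c1 \<in> Z" "c2 \<in> Z" for c1 c2
      proof -
        consider "c1 = c2" | "l.lt c1 c2" | "l.lt c2 c1"
          using l.le_total[of c1 c2] Z(2)[OF c12(1)] Z(2)[OF c12(2)] l.lt_Field(1) unfolding l.lt_def by metis
        then show ?thesis using Z(7)[OF c12(1)] Z(7)[OF c12(2)] Z(1) c12 by cases auto
      qed
      have ch: "initial A B \<or> initial B A" if "A \<in> F" "B \<in> F" for A B
        using that Zch Z(5) unfolding F_def by auto
      have FT: "F \<subseteq> T" using x Z(3) unfolding F_def by auto
      \<comment> \<open>Fewer than \<open>k\<close> steps precede \<open>c\<close>, so completeness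
        gives a node \<open>W\<close> above all of them.\<close>
      have "inj_on e Z"
      proof (rule inj_onI)
        fix c1 c2 assume c12: "c1 \<in> Z" "c2 \<in> Z" "e c1 = e c2"
        have "c1 \<in> C d" "c2 \<in> C d" using c12 Z(1) Cx(1) by auto
        then show "c1 = c2"
          using c12 e(2)[of c1 c2] e(2)[of c2 c1] l.le_total[of c1 c2] C_Field[OF d(1)] K.lt_irrefl
          unfolding l.lt_def by (metis subsetD)
      qed
      moreover have "e ` Z \<subseteq> underS k (e c)"
        using Z(1,2) Cx(1) c e(2) unfolding K.underS_lt by blast
      ultimately have "|Z| \<le>o |underS k (e c)|" using card_of_ordLeq by blast
      then have "|Z| <o k" using underS_k_small[OF e(1)] Cx(1)[OF c] ordLeq_ordLess_trans by blast
      then have Fs: "|F| <o k" unfolding F_def by (intro insert_small image_small)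
      define W where "W = \<Union>F"
      have WT: "W \<in> T" unfolding W_def using T_Union[OF FT _ Fs ch] by (auto simp: F_def)
      have Fi: "initial A W" if "A \<in> F" for A unfolding W_def using initial_Union[OF ch that] .
      have cof: "\<exists>A\<in>F. l.lt g (ht A)" if "l.lt g (ht W)" for g
        using ht_Union_less[OF ch _ that[unfolded W_def]] FT T_well_ordered by blast
      have Flt: "l.lt (ht A) c" if "A \<in> F" for A
        using that Z(2,4) Cx(2)[OF c] unfolding F_def by auto
      have cF: "c \<in> Field l" using Cx(3)[OF c] l.lt_Field by blast
      have Wc: "(ht W, c) \<in> l"
      proof -
        have "\<not> l.lt c (ht W)" using cof Flt l.lt_trans l.lt_irrefl by blast
        then show ?thesis using l.not_lt[OF cF ht_Field[OF T_well_ordered[OF WT]]] by blast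
      qed
      have pc: "(b, p (e c)) \<in> q" "lt (p (e c)) (s (e c))" using ps(1) e(1) Cx(1)[OF c] by auto
      \<comment> \<open>All earlier bounds \<open>s (e c')\<close> are at most
        \<open>p (e c)\<close>, so the subinterval up to \<open>s (e c)\<close> is still
        free.\<close>
      have bdW: "bounded_by W (p (e c))"
      proof -
        have "bounded_by A (p (e c))" if AF: "A \<in> F" for A
        proof -
          consider "A = x" | c' where "c' \<in> Z" "A = f c'" using AF unfolding F_def by blast
          then show ?thesis
          proof cases
            case 1 then show ?thesis using bounded_by_mono[OF x(3) _ pc(1)] by simp
          next
            case 2
            then have "(s (e c'), p (e c)) \<in> q" using ps(2) e(2) Z(1,2) Cx(1) c by auto
            then show ?thesis using bounded_by_mono[OF Z(6)[OF 2(1)]] 2 by simp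
          qed
        qed
        moreover have "F \<noteq> {}" by (simp add: F_def)
        ultimately show ?thesis unfolding bounded_by_def W_def by blast
      qed
      have xF: "x \<in> F" by (simp add: F_def)
      have fF: "f c' \<in> F" if "c' \<in> Cx" "l.lt c' c" for c' using that by (simp add: F_def Z_def)
      have extc: "extendible c" using ext Cx(3)[OF c] .
      have fin: "\<Phi> f c v" if "v \<in> T" "ht v = c" "initial W v" "bounded_by v (s (e c))"
        "c \<notin> limit_points l (C d) \<and> reachable (D d \<xi> c) (nodes_below P d) c \<longrightarrow>
        (\<exists>z. initial z v \<and> l.lt (ht z) c \<and> D d \<xi> c z)" for v
        unfolding \<Phi>_def using that Fi[OF xF] Fi[OF fF] initial_trans by blast
      show ?thesis
      proof (cases "ht W = c")
        case True
        \<comment> \<open>If \<open>W\<close> has height \<open>c\<close> already, nothing can be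
          inserted. But then the earlier heights are cofinal in \<open>c\<close>, so
          \<open>c\<close> is an accumulation point and carries no demand.\<close>
        have "c \<in> limit_points l (C d)"
        proof -
          have "\<exists>c'\<in>C d \<inter> underS l c. c' \<in> aboveS l g" if g: "l.lt g c" for g
          proof -
            have "\<exists>g'. (g, g') \<in> l \<and> (ht x, g') \<in> l \<and> l.lt g' c"
              using g Cx(2)[OF c] l.le_total[of g "ht x"] l.le_refl[of g] l.le_refl[of "ht x"]
                l.lt_Field(1)[OF g] l.lt_Field(1)[OF Cx(2)[OF c]] by blast
            then obtain g' where g': "(g, g') \<in> l" "(ht x, g') \<in> l" "l.lt g' c" by blast
            then obtain A where A: "A \<in> F" "l.lt g' (ht A)" using cof[of g'] True by blast
            then have "A \<noteq> x" using g' l.le_lt_trans l.lt_irrefl by blast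
            then obtain c' where c': "c' \<in> Z" "A = f c'" using A unfolding F_def by blast
            then have "l.lt g c'" "l.lt c' c" "c' \<in> C d" using A Z(1,2,4) g' l.le_lt_trans Cx(1) by auto
            then show ?thesis unfolding l.underS_lt l.aboveS_lt by blast
          qed
          then show ?thesis using cF Cx(2)[OF c] unfolding limit_points_def l.underS_lt by blast
        qed
        then show ?thesis using fin[OF WT True] bounded_by_lt[OF bdW pc(2)] by auto
      next
        case False
        then have Wlt: "l.lt (ht W) c" using Wc unfolding l.lt_def by blast
        show ?thesis
        proof (cases "reachable (D d \<xi> c) (nodes_below P d) c")
          case True
          \<comment> \<open>The subinterval is split at \<open>m\<close>: the lower part is spent on
            the witness \<open>z\<close>, the upper part on reaching level \<open>c\<close>.\<close>
          obtain m where m: "lt (p (e c)) m" "lt m (s (e c))" using dense pc by blast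
          obtain z where z: "z \<in> T" "l.lt (ht z) c" "initial W z" "bounded_by z m" "D d \<xi> c z"
            using reachable_below[OF l.lt_le[OF Cx(3)[OF c]] True WT Wlt bdW m(1)] by blast
          obtain v where v: "v \<in> T" "ht v = c" "initial z v" "bounded_by v (s (e c))"
            using extc z(1) l.lt_le[OF z(2)] z(4) m(2) unfolding extendible_def by blast
          show ?thesis using fin[OF v(1,2) initial_trans[OF z(3) v(3)] v(4)] v(3) z by blast
        next
          case False
          obtain v where v: "v \<in> T" "ht v = c" "initial W v" "bounded_by v (s (e c))"
            using extc WT l.lt_le[OF Wlt] bdW pc(2) unfolding extendible_def by blast
          show ?thesis using fin[OF v] False by blast
        qed
      qed
    qed (simp add: \<Phi>_def)
  qed
  then obtain f where f: "\<And>c. \<Phi> f c (f c)" by blast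
  have Z: "f c \<in> T" "ht (f c) = c" "initial x (f c)" "bounded_by (f c) (s (e c))"
      "\<And>c'. c' \<in> Cx \<Longrightarrow> l.lt c' c \<Longrightarrow> initial (f c') (f c)"
      "c \<notin> limit_points l (C d) \<Longrightarrow> reachable (D d \<xi> c) (nodes_below P d) c \<Longrightarrow>
        \<exists>z. initial z (f c) \<and> l.lt (ht z) c \<and> D d \<xi> c z" if "c \<in> Cx" for c
    using f[of c] that unfolding \<Phi>_def by auto
  define F where "F = insert x (f ` Cx)"
  have Zch: "initial (f c1) (f c2) \<or> initial (f c2) (f c1)" if c12: "c1 \<in> Cx" "c2 \<in> Cx" for c1 c2
  proof -
    consider "c1 = c2" | "l.lt c1 c2" | "l.lt c2 c1"
      using l.le_total[of c1 c2] Cx(3)[OF c12(1)] Cx(3)[OF c12(2)] l.lt_Field(1) unfolding l.lt_def by metis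
    then show ?thesis using Z(5)[OF c12(1)] Z(5)[OF c12(2)] c12 by cases auto
  qed
  have ch: "initial A B \<or> initial B A" if "A \<in> F" "B \<in> F" for A B
    using that Zch Z(3) unfolding F_def by auto
  have FT: "F \<subseteq> T" using x Z(1) unfolding F_def by auto
  then have Fw: "F \<subseteq> well_ordered" using T_well_ordered by blast
  define A where "A = \<Union>F"
  have Aw: "A \<in> well_ordered" unfolding A_def using well_ordered_Union[OF ch Fw] .
  have Fi: "initial B A" if "B \<in> F" for B unfolding A_def using initial_Union[OF ch that] .
  have cof: "\<exists>B\<in>F. l.lt g (ht B)" if "l.lt g (ht A)" for g
    using ht_Union_less[OF ch Fw that[unfolded A_def]] .
  have Flt: "l.lt (ht B) d" if "B \<in> F" for B
    using that x Z(2) Cx(3) unfolding F_def by auto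
  have xF: "x \<in> F" by (simp add: F_def)
  have fF: "f c \<in> F" if "c \<in> Cx" for c using that by (simp add: F_def)
  \<comment> \<open>\<open>C d\<close> is cofinal in \<open>d\<close>, so the union of the climb has
    height exactly \<open>d\<close>.\<close>
  have htA: "ht A = d"
  proof -
    have "\<not> l.lt d (ht A)" using cof Flt l.lt_trans l.lt_irrefl by blast
    moreover have "\<not> l.lt (ht A) d"
    proof
      assume "l.lt (ht A) d"
      then obtain g where g: "l.lt (ht A) g" "l.lt g d" using d(2) unfolding limit_ht_def by blast
      then obtain c where c: "c \<in> C d" "(g, c) \<in> l" using C_above by blast
      have "(ht x, ht A) \<in> l" using ht_mono[OF Aw Fi[OF xF]] .
      then have lc: "l.lt (ht A) c" "l.lt (ht x) c" using g c l.lt_le_trans l.le_lt_trans by blast+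
      then have cx: "c \<in> Cx" using c by (simp add: Cx_def)
      then have "(c, ht A) \<in> l" using ht_mono[OF Aw Fi[OF fF[OF cx]]] Z(2)[OF cx] by simp
      then show False using lc l.lt_le_trans l.lt_irrefl by blast
    qed
    ultimately show ?thesis using l.le_total[OF ht_Field[OF Aw] d(1)] unfolding l.lt_def by metis
  qed
  have "bounded_by A b'"
  proof -
    have "bounded_by B b'" if BF: "B \<in> F" for B
    proof -
      consider "B = x" | c where "c \<in> Cx" "B = f c" using BF unfolding F_def by blast
      then show ?thesis
      proof cases
        case 1 then show ?thesis using bounded_by_lt x by blast
      next
        case 2 then show ?thesis using bounded_by_mono[OF Z(4)[OF 2(1)]] ps(1) e(1) Cx(1) by auto
      qed
    qed
    then show ?thesis using xF unfolding bounded_by_def A_def by blast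
  qed
  moreover have "B \<in> nodes_below P d" if B: "initial B A" "B \<noteq> A" for B
  proof -
    have lt: "l.lt (ht B) (ht A)" using ht_less[OF Aw B] .
    then obtain B' where B': "B' \<in> F" "l.lt (ht B) (ht B')" using cof by blast
    then have "initial B B'" using initial_of_ht[OF Aw B(1) Fi[OF B'(1)]] l.lt_le by blast
    then show ?thesis using T_ini[of B' B] FT B' lt htA unfolding nodes_below_def by auto
  qed
  moreover have "\<exists>z. initial z A \<and> z \<noteq> A \<and> D d \<xi> c z"
    if c: "c \<in> C d - limit_points l (C d)" "l.lt (ht x) c" "reachable (D d \<xi> c) (nodes_below P d) c" for c
  proof -
    have cx: "c \<in> Cx" using c by (simp add: Cx_def)
    obtain z where z: "initial z (f c)" "l.lt (ht z) c" "D d \<xi> c z" using Z(6)[OF cx] c by blast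
    have "z \<noteq> A" using z(2) Cx(3)[OF cx] htA l.lt_trans l.lt_irrefl by blast
    then show ?thesis using z initial_trans[OF z(1) Fi[OF fF[OF cx]]] by blast
  qed
  ultimately have "good_branch D (nodes_below P d) d x b' \<xi> A"
    unfolding good_branch_def using Aw htA Fi[OF xF] by blast
  then show ?thesis by blast
qed

lemma branching_branch:
  assumes d: "d \<in> branching" and ext: "\<And>g. l.lt g d \<Longrightarrow> extendible g"
    and x: "x \<in> T" "l.lt (ht x) d" "bounded_by x b" "lt b b'" and \<xi>: "\<xi> \<in> Field k"
  shows "\<exists>A\<in>T. ht A = d \<and> good_branch D (nodes_below P d) d x b' \<xi> A"
proof -
  have dF: "d \<in> Field l" using d by (simp add: branching_def)
  let ?G = "good_branch D (nodes_below P d) d x b' \<xi>"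
  have ex: "\<exists>A. ?G A" using branch_ex[OF dF branching_lim[OF d] ext x] .
  then have G: "?G (SOME A. ?G A)" by (rule someI_ex)
  have "x \<in> nodes_below P d" "b' \<in> Field q" using x lt_Field by (auto simp: nodes_below_def)
  then have "(SOME A. ?G A) \<in> P d"
    unfolding P_eq[of d] chosen_def using \<xi> ex by (auto intro!: image_eqI[of _ _ "(x, b', \<xi>)"])
  then show ?thesis using branching_P[OF d] G by blast
qed

lemma extendible_all: "g \<in> Field l \<Longrightarrow> extendible g"
proof (induction rule: l_induct)
  case (less g)
  show ?case unfolding extendible_def
  proof (intro ballI impI allI)
    fix A b b' assume A: "A \<in> T" "(ht A, g) \<in> l" and b: "bounded_by A b \<and> lt b b'"
    show "\<exists>B\<in>T. ht B = g \<and> initial A B \<and> bounded_by B b'"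
    proof (cases "ht A = g")
      case True
      then show ?thesis using A b bounded_by_lt by auto
    next
      case False
      then have lt: "l.lt (ht A) g" using A by (simp add: l.lt_def)
      show ?thesis
      proof (cases "limit_ht g")
        case True
        show ?thesis
        proof (cases "g \<in> branching")
          case branching: True
          obtain \<xi> where "\<xi> \<in> Field k" using k_inf by fastforce
          then show ?thesis
            using branching_branch[OF branching less(2) A(1) lt, of b b' \<xi>] b unfolding good_branch_def by blast
        next
          case False
          \<comment> \<open>Nothing is chosen on this level, so any index will do.\<close>
          obtain B where B: "good_branch D (nodes_below P g) g A b' undefined B"
            using branch_ex[OF less(1) True less(2) A(1) lt] b by blast
          then have "B \<in> T" using T_limit[of B b'] True False unfolding good_branch_def nodes_below_def by blast
          then show ?thesis using B unfolding good_branch_def by blast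
        qed
      next
        case False
        \<comment> \<open>\<open>g\<close> is the successor of \<open>a\<close>: extend to level
          \<open>a\<close> below some \<open>m\<close> under \<open>b'\<close>, then add
          \<open>b'\<close> itself as a new top element.\<close>
        then obtain a where a: "l.lt a g" "\<And>a'. l.lt a a' \<Longrightarrow> \<not> l.lt a' g" unfolding limit_ht_def by blast
        have "(ht A, a) \<in> l" using a(2)[of "ht A"] lt l.not_lt l.lt_Field[OF a(1)] ht_Field[OF T_well_ordered[OF A(1)]] by blast
        moreover obtain m where m: "lt b m" "lt m b'" using dense b by blast
        ultimately obtain B where B: "B \<in> T" "ht B = a" "initial A B" "bounded_by B m"
          using less(2)[OF a(1)] A b unfolding extendible_def by blast
        note I = T_insert[OF B(1) B(4) m(2)]
        have "(ht (insert b' B), g) \<in> l"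
        proof (rule ccontr)
          assume "\<not> ?thesis"
          then have "l.lt g (ht (insert b' B))" using l.not_le ht_Field[OF T_well_ordered[OF I(1)]] less(1) by blast
          then have "(g, ht B) \<in> l" using I(6) by blast
          then show False using a(1) B(2) l.lt_le_trans l.lt_irrefl by blast
        qed
        then have "ht (insert b' B) = g" using a(2) I(5) B(2) unfolding l.lt_def by blast
        then show ?thesis using I(1-3) initial_trans[OF B(3)] by blast
      qed
    qed
  qed
qed

lemma extend:
  assumes "A \<in> T" "(ht A, g) \<in> l" "bounded_by A b" "lt b b'"
  shows "\<exists>B\<in>T. ht B = g \<and> initial A B \<and> bounded_by B b'"
  using extendible_all[of g] assms l.le_Field unfolding extendible_def by blast

text \<open>By induction there are at most \<open>k\<close> nodes below \<open>a\<close>. A level in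
  \<open>branching\<close> has at most one node per chosen triple. On any other level
  \<open>C a\<close> has fewer than \<open>k\<close> elements, and a node is determined by its
  segments with heights in \<open>C a\<close> and at most one further element, so that
  \<open>small_Func\<close> applies.\<close>

lemma level_small:
  assumes "a \<in> Field l"
  shows "|{A \<in> T. ht A = a}| \<le>o k"
  using assms
proof (induction rule: l_induct)
  case (less a)
  have "nodes_below P a = (\<Union>b\<in>underS l a. {A \<in> T. ht A = b})"
    by (auto simp: nodes_below_def l.underS_lt)
  then have X: "|nodes_below P a| \<le>o k"
    using UN_le[OF underS_l_small[OF less(1)], of "\<lambda>b. {A \<in> T. ht A = b}"] less(2)
    by (simp add: l.underS_lt)
  have Fq: "|Field q| \<le>o k" using Field_k q_Field by simp
  show ?case
  proof (cases "a \<in> branching")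
    case True
    have sub: "{A \<in> T. ht A = a} \<subseteq> P a" using True unfolding nodes_def by auto
    have "|{(x, b, \<xi>). x \<in> nodes_below P a \<and> b \<in> Field q \<and> \<xi> \<in> Field k \<and> (\<exists>A. good_branch D (nodes_below P a) a x b \<xi> A)}|
        \<le>o |nodes_below P a \<times> Field q \<times> Field k|"
      by (rule card_of_mono1) auto
    also have "|nodes_below P a \<times> Field q \<times> Field k| \<le>o k" using X Fq Field_k by (intro Times_le)
    finally have "|P a| \<le>o k" unfolding P_eq[of a] chosen_def by (rule image_le)
    then show ?thesis using card_of_mono1[OF sub] ordLeq_transitive by blast
  next
    case False
    have "Restr l (C a) <o k"
      using False C_type[OF less(1)] less(1) unfolding branching_def ordLeq_iff_ordLess_or_ordIso by blast
    moreover have "|C a| \<le>o Restr l (C a)"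
      using C_well_ordered[OF less(1)] card_of_least unfolding l.well_ordered_def by blast
    ultimately have Cs: "|C a| <o k" using ordLeq_ordLess_trans by blast
    \<comment> \<open>What the segments can leave over: nothing, or a single top element.\<close>
    define S where "S = insert {} ((\<lambda>y. {y}) ` Field q)"
    have Ss: "|S| \<le>o k"
    proof -
      have "S = {{}} \<union> (\<lambda>y. {y}) ` Field q" by (auto simp: S_def)
      moreover have "|{{}} :: 'a set set| \<le>o k" using finite_small ordLess_imp_ordLeq by blast
      ultimately show ?thesis
        using card_of_Un_ordLeq_infinite_Field[OF k_inf _ image_le[OF Fq] k_card] by metis
    qed
    have "|Func (C a) (nodes_below P a) \<times> S| \<le>o k" using small_Func[OF Cs X] Ss by (intro Times_le)
    moreover have "{A \<in> T. ht A = a} \<subseteq> (\<lambda>(f, s). \<Union>(f ` C a) \<union> s) ` (Func (C a) (nodes_below P a) \<times> S)"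
    proof
      fix A assume "A \<in> {A \<in> T. ht A = a}"
      then have A: "A \<in> T" "A \<in> well_ordered" "ht A = a" using T_well_ordered by auto
      define f where "f c = (if c \<in> C a then cut A c else undefined)" for c
      have f: "initial (f c) A" "ht (f c) = c" if "c \<in> C a" for c
        using that cut_ini[OF A(2)] ht_cut[OF A(2)] C_lt[OF less(1) that] A(3) l.lt_le by (auto simp: f_def)
      have F: "f \<in> Func (C a) (nodes_below P a)"
        unfolding Func_def nodes_below_def using f T_ini[OF A(1)] C_lt[OF less(1)] by (auto simp: f_def)
      define s where "s = A - \<Union>(f ` C a)"
      \<comment> \<open>The segment of \<open>A\<close> below \<open>y'\<close> has height below
        \<open>a\<close>, so some \<open>f c\<close> contains it. It cannot contain
        \<open>y\<close>, which lies in no \<open>f c\<close>. Hence a remaining element is a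
        maximum of \<open>A\<close>.\<close>
      have le: "(y', y) \<in> q" if y: "y \<in> s" "y' \<in> A" for y y'
      proof (rule ccontr)
        assume n: "(y', y) \<notin> q"
        have yq: "y \<in> Field q" "y' \<in> Field q" using y well_orderedD[OF A(2)] by (auto simp: s_def)
        let ?B = "{z \<in> A. lt z y'}"
        have B: "initial ?B A" using initial_below well_orderedD A(2) by blast
        have "?B \<noteq> A" using y lt_irrefl by blast
        then have "l.lt (ht ?B) a" using ht_less[OF A(2) B] A(3) by blast
        then obtain c where c: "c \<in> C a" "(ht ?B, c) \<in> l" using C_above by blast
        have "initial ?B (f c)" using initial_of_ht[OF A(2) B f(1)[OF c(1)]] c f(2) by simp
        moreover have "y \<in> ?B" using n not_le[of y y'] yq y by (simp add: s_def)
        ultimately show False using y(1) c(1) initial_subset unfolding s_def by blast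
      qed
      have "s \<in> S"
      proof (cases "s = {}")
        case False
        then obtain y where y: "y \<in> s" by blast
        have "y' = y" if "y' \<in> s" for y'
          using le_antisym[of y' y] le[OF y, of y'] le[OF that, of y] y that by (simp add: s_def)
        then have "s = {y}" using y by blast
        moreover have "y \<in> Field q" using y well_orderedD[OF A(2)] by (auto simp: s_def)
        ultimately show ?thesis by (simp add: S_def)
      qed (simp add: S_def)
      moreover have "\<Union>(f ` C a) \<subseteq> A" using initial_subset[OF f(1)] by (rule UN_least)
      then have "A = \<Union>(f ` C a) \<union> s" by (auto simp: s_def)
      ultimately show "A \<in> (\<lambda>(f, s). \<Union>(f ` C a) \<union> s) ` (Func (C a) (nodes_below P a) \<times> S)"
        using F by (intro image_eqI[of _ _ "(f, s)"]) auto
    qed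
    ultimately show ?thesis using ordLeq_transitive[OF card_of_mono1 image_le] by blast
  qed
qed

end

section \<open>The tree order\<close>

text \<open>\<open>Under\<close> and \<open>Above\<close> form a Galois connection, so their
  composition is idempotent.\<close>

lemma cut_closed:
  assumes "X \<subseteq> Field r"
  shows "Under r (Above r (Under r (Above r X))) = Under r (Above r X)"
  using assms unfolding Under_def Above_def by blast

context tree_family
begin

definition tree :: "'a set rel" where
  "tree = {(A, B). A \<in> T \<and> B \<in> T \<and> initial A B}"

lemma Field_tree: "Field tree = T"
  by (auto simp: tree_def Field_def)

lemma underS_tree: "A \<in> T \<Longrightarrow> underS tree A = {B. initial B A \<and> B \<noteq> A}"
  using T_ini by (auto simp: tree_def underS_def)

lemma partial_order_tree: "Partial_order tree"
  unfolding order_on_defs refl_on_def trans_def antisym_def Field_tree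
  using initial_trans initial_antisym by (auto simp: tree_def)

text \<open>Sending \<open>a\<close> to the set of elements of \<open>A\<close> below
  \<open>a\<close> is an isomorphism from \<open>A\<close> onto its predecessors in the tree. This
  makes \<open>ht\<close> the height in the tree.\<close>

lemma Restr_tree:
  assumes A: "A \<in> T"
  shows "Well_order (Restr tree (underS tree A))" "Field (Restr tree (underS tree A)) = underS tree A"
    "Restr q A =o Restr tree (underS tree A)"
proof -
  define f where "f a = {x \<in> A. lt x a}" for a
  have w: "A \<in> well_ordered" using T_well_ordered A .
  have Aq: "A \<subseteq> Field q" using well_orderedD w .
  have F: "Field (Restr q A) = A" using well_ordered_Field_Restr w .
  have W: "Well_order (Restr q A)" using well_ordered_Well_order w .
  have iff: "initial (f a) (f b) \<longleftrightarrow> (a, b) \<in> q" if "a \<in> A" "b \<in> A" for a b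
  proof
    assume "initial (f a) (f b)"
    then have "\<not> lt b a" using initial_subset[of "f a" "f b"] that lt_irrefl by (auto simp: f_def)
    then show "(a, b) \<in> q" using not_lt[of b a] that Aq by blast
  next
    assume "(a, b) \<in> q"
    then have "f a \<subseteq> f b" using lt_le_trans by (auto simp: f_def)
    moreover have "f b \<subseteq> A" by (auto simp: f_def)
    ultimately show "initial (f a) (f b)" using initial_below[OF Aq, of a] initial_restrict by (simp add: f_def)
  qed
  have inj: "inj_on f A"
    using iff le_antisym initial_refl by (intro inj_onI) metis
  have im: "f ` A = underS tree A"
    unfolding underS_tree[OF A]
  proof (intro equalityI subsetI)
    fix B assume "B \<in> f ` A"
    then obtain a where "a \<in> A" "B = f a" by blast
    then show "B \<in> {B. initial B A \<and> B \<noteq> A}" using initial_below[OF Aq] lt_irrefl by (auto simp: f_def)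
  next
    fix B assume "B \<in> {B. initial B A \<and> B \<noteq> A}"
    then obtain b where "b \<in> A" "B = {x \<in> A. lt x b}" using initial_proper[OF _ _ w] by blast
    then show "B \<in> f ` A" by (auto simp: f_def)
  qed
  have fT: "f a \<in> T" if "a \<in> A" for a using T_ini[OF A initial_below[OF Aq]] by (simp add: f_def)
  have eq: "Restr tree (underS tree A) = dir_image (Restr q A) f"
  proof -
    have "(f a, f b) \<in> tree \<longleftrightarrow> (a, b) \<in> q" if "a \<in> A" "b \<in> A" for a b
      using that iff fT by (simp add: tree_def)
    then show ?thesis unfolding im[symmetric] dir_image_def by auto
  qed
  show "Well_order (Restr tree (underS tree A))" "Field (Restr tree (underS tree A)) = underS tree A"
    "Restr q A =o Restr tree (underS tree A)"
    unfolding eq using Well_order_dir_image[OF W, of f] dir_image_Field[of "Restr q A" f]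
      dir_image_ordIso[OF W, of f] inj F im by simp_all
qed

lemma level_tree: "a \<in> Field l \<Longrightarrow> level l tree a = {A \<in> T. ht A = a}"
  unfolding level_def Field_tree
proof (intro Collect_cong conj_cong refl)
  fix A assume a: "a \<in> Field l" and A: "A \<in> T"
  show "Restr tree (underS tree A) =o Restr l (underS l a) \<longleftrightarrow> ht A = a"
  proof
    assume "Restr tree (underS tree A) =o Restr l (underS l a)"
    then show "ht A = a" using ht_eqI[OF a ordIso_transitive[OF Restr_tree(3)[OF A]]] by simp
  next
    assume "ht A = a"
    then show "Restr tree (underS tree A) =o Restr l (underS l a)"
      using ordIso_transitive[OF ordIso_symmetric[OF Restr_tree(3)[OF A]] ht_iso[OF T_well_ordered[OF A]]] by simp
  qed
qed

lemma is_tree_tree: "is_tree tree"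
  unfolding is_tree_def Field_tree using partial_order_tree Restr_tree Field_tree by auto

lemma ht_empty_le: "a \<in> Field l \<Longrightarrow> (ht {}, a) \<in> l"
  using ht_surj[OF well_ordered_empty, of a] initial_subset l.not_lt[of a "ht {}"] ht_Field[OF well_ordered_empty] by (metis subset_empty)

lemma bounded_by_empty: "bounded_by {} q0"
  using q0 le_refl by (simp add: bounded_by_def)

section \<open>The required properties of the tree\<close>

lemma lambda_tree_tree: "lambda_tree l tree"
  unfolding lambda_tree_def
proof (intro conjI ballI)
  show "is_tree tree" by (rule is_tree_tree)
  show "|level l tree a| <o l" if "a \<in> Field l" for a
    unfolding level_tree[OF that] less_l by (rule level_small[OF that])
  show "level l tree a \<noteq> {}" if a: "a \<in> Field l" for a
  proof -
    obtain b where "lt q0 b" using bounded_by_above[OF bounded_by_empty] by blast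
    then obtain B where "B \<in> T" "ht B = a" using extend[OF T_empty ht_empty_le[OF a] bounded_by_empty] by blast
    then show ?thesis using level_tree[OF a] by auto
  qed
  show "Field tree = (\<Union>a\<in>Field l. level l tree a)"
    using level_tree ht_Field T_well_ordered by (auto simp: Field_tree)
qed

text \<open>The union of a cofinal branch would be a well-ordered subset of \<open>q\<close> whose
  height is at least every element of \<open>l\<close>. But it is an element of \<open>l\<close>,
  which has no maximum.\<close>

lemma aronszajn_tree_tree: "aronszajn_tree l tree"
  unfolding aronszajn_tree_def
proof (intro conjI lambda_tree_tree notI)
  assume "\<exists>B. cofinal_branch l tree B"
  then obtain B where B: "B \<in> Chains tree" "\<And>a. a \<in> Field l \<Longrightarrow> B \<inter> level l tree a \<noteq> {}"
    unfolding cofinal_branch_def by blast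
  have ch: "initial X Y \<or> initial Y X" if "X \<in> B" "Y \<in> B" for X Y
    using B(1) that unfolding Chains_def tree_def by blast
  have BT: "B \<subseteq> well_ordered" using B(1) T_well_ordered unfolding Chains_def tree_def by blast
  have W: "\<Union>B \<in> well_ordered" using well_ordered_Union[OF ch BT] .
  obtain a where a: "l.lt (ht (\<Union>B)) a" using l_no_max ht_Field[OF W] by blast
  then have aF: "a \<in> Field l" using l.lt_Field by blast
  then obtain A where A: "A \<in> B" "ht A = a" using B(2)[OF aF] level_tree[OF aF] by blast
  have "(a, ht (\<Union>B)) \<in> l" using ht_mono[OF W initial_Union[OF ch A(1)]] A by blast
  then show False using a l.lt_le_trans l.lt_irrefl by blast
qed

lemma normal_tree_tree: "normal_tree l tree"
  unfolding normal_tree_def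
proof (intro conjI ballI allI impI)
  fix a x g assume a: "a \<in> Field l" "x \<in> level l tree a" "g \<in> aboveS l a"
  have g: "l.lt a g" "g \<in> Field l" using a l.lt_Field unfolding l.aboveS_lt by blast+
  have x: "x \<in> T" "ht x = a" using a level_tree by auto
  obtain b b' where "bounded_by x b" "lt b b'" using T_bd[OF x(1)] bounded_by_above by blast
  then obtain y where y: "y \<in> T" "ht y = g" "initial x y" using extend[OF x(1)] x g l.lt_le by metis
  moreover have "x \<noteq> y" using x y g l.lt_irrefl by blast
  ultimately show "\<exists>y\<in>level l tree g. y \<in> aboveS tree x"
    using level_tree[OF g(2)] x unfolding aboveS_def tree_def by blast
next
  fix a x y assume a: "limit_ordinal l a" and x: "x \<in> level l tree a" and y: "y \<in> level l tree a" and ne: "x \<noteq> y"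
  have aF: "a \<in> Field l" and limit_ht: "limit_ht a"
    using a unfolding limit_ordinal_def limit_ht_def l.underS_lt l.aboveS_lt by blast+
  have xy: "x \<in> T" "ht x = a" "y \<in> T" "ht y = a" using x y level_tree[OF aF] by auto
  show "underS tree x \<noteq> underS tree y"
  proof
    assume eq: "underS tree x = underS tree y"
    \<comment> \<open>A node of limit height is the union of its proper segments.\<close>
    have "u \<subseteq> v" if uv: "u \<in> T" "ht u = a" "v \<in> T" "underS tree u = underS tree v" for u v
    proof
      fix z assume "z \<in> u"
      then obtain B where B: "initial B u" "B \<noteq> u" "z \<in> B" using mem_proper[OF T_well_ordered[OF uv(1)]] uv(2) limit_ht by blast
      then have "initial B v" using uv(4) underS_tree[OF uv(1)] underS_tree[OF uv(3)] by blast
      then show "z \<in> v" using B initial_subset by blast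
    qed
    then show False using xy eq ne by (metis subset_antisym)
  qed
next
  fix x assume "x \<in> Field tree"
  then have x: "x \<in> T" by (simp add: Field_tree)
  obtain b b1 where b: "bounded_by x b" "lt b b1" using T_bd[OF x] bounded_by_above by blast
  \<comment> \<open>Different new top elements over \<open>x\<close> give incomparable
    nodes.\<close>
  obtain m where m: "lt b m" "lt m b1" using dense b by blast
  note I = T_insert[OF x b] and J = T_insert[OF x b(1) m(1)]
  have ne: "m \<noteq> b1" using m lt_irrefl by blast
  have "insert m x \<in> aboveS tree x" "insert b1 x \<in> aboveS tree x"
    using x I(1,3,4) J(1,3,4) by (auto simp: aboveS_def tree_def)
  moreover have "\<not> insert m x \<subseteq> insert b1 x" "\<not> insert b1 x \<subseteq> insert m x"
    using I(4) J(4) ne by blast+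
  ultimately show "\<exists>y\<in>aboveS tree x. \<exists>z\<in>aboveS tree x. (y, z) \<notin> tree \<and> (z, y) \<notin> tree"
    using initial_subset[of "insert m x" "insert b1 x"] initial_subset[of "insert b1 x" "insert m x"]
    unfolding tree_def by (intro bexI[of _ "insert m x"] bexI[of _ "insert b1 x"]) auto
qed

lemma complete_tree_tree: "complete_tree k tree"
  unfolding complete_tree_def
proof (intro ballI impI)
  fix c assume c: "c \<in> Chains tree" "Restr tree c <o k"
  have ch: "initial X Y \<or> initial Y X" if "X \<in> c" "Y \<in> c" for X Y
    using c(1) that unfolding Chains_def tree_def by blast
  have cT: "c \<subseteq> T" using c(1) unfolding Chains_def tree_def by blast
  show "\<exists>u\<in>Field tree. \<forall>x\<in>c. (x, u) \<in> tree"
  proof (cases "c = {}")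
    case True then show ?thesis using T_empty Field_tree by blast
  next
    case False
    have "Field (Restr tree c) = c"
      using cT by (auto simp: Field_def tree_def)
    moreover have "Well_order (Restr tree c)" using c(2) by (auto simp: ordLess_def)
    ultimately have "|c| <o k" using c(2) card_of_least ordLeq_ordLess_trans by metis
    then have "\<Union>c \<in> T" using T_Union[OF cT False _ ch] by blast
    then show ?thesis using initial_Union[OF ch] cT unfolding Field_tree by (auto simp: tree_def)
  qed
qed

text \<open>A node is sent to the cut generated by \<open>q0\<close> and its elements, that is, to
  its supremum in the completion.\<close>

lemma R_embeddable_tree:
  assumes e: "\<And>x. x \<in> Field q \<Longrightarrow> e x \<in> Field (Q_order k)"
    and iff: "\<And>x y. x \<in> Field q \<Longrightarrow> y \<in> Field q \<Longrightarrow> (e x, e y) \<in> Q_order k \<longleftrightarrow> (x, y) \<in> q"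
  shows "R_embeddable k tree"
proof -
  let ?Q = "Q_order k"
  define X where "X A = e ` insert q0 A" for A
  define f where "f A = Under ?Q (Above ?Q (X A))" for A
  have XF: "X A \<subseteq> Field ?Q" if "A \<in> T" for A
    using that e q0 well_orderedD[OF T_well_ordered[OF that]] by (auto simp: X_def)
  have bdX: "e b \<in> Above ?Q (X A)" if "A \<in> T" "bounded_by A b" for A b
  proof -
    have xb: "(x, b) \<in> q" if "x \<in> insert q0 A" for x using \<open>bounded_by A b\<close> that unfolding bounded_by_def by blast
    have "(e x, e b) \<in> Q_order k" if "x \<in> insert q0 A" for x
      using xb[OF that] iff le_Field by blast
    then show ?thesis using e le_Field(2)[OF xb[of q0]] by (auto simp: Above_def X_def)
  qed
  have Xf: "X A \<subseteq> f A" if "A \<in> T" for A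
    using XF[OF that] unfolding f_def Under_def Above_def by blast
  have R: "(A, B) \<in> R_order k \<longleftrightarrow> A \<noteq> {} \<and> Above ?Q A \<noteq> {} \<and> A = Under ?Q (Above ?Q A) \<and>
      B \<noteq> {} \<and> Above ?Q B \<noteq> {} \<and> B = Under ?Q (Above ?Q B) \<and> A \<subseteq> B" for A B
    unfolding R_order_def dedekind_completion_def Let_def by auto
  have cut: "f A \<noteq> {} \<and> Above ?Q (f A) \<noteq> {} \<and> f A = Under ?Q (Above ?Q (f A))" if A: "A \<in> T" for A
  proof (intro conjI)
    show "f A \<noteq> {}" using Xf[OF A] by (auto simp: X_def)
    obtain b where "bounded_by A b" using T_bd A by blast
    then have b: "e b \<in> Above ?Q (X A)" using bdX A by blast
    then have "e b \<in> Above ?Q (f A)" unfolding f_def Under_def Above_def by blast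
    then show "Above ?Q (f A) \<noteq> {}" by blast
    show "f A = Under ?Q (Above ?Q (f A))" using cut_closed[OF XF[OF A]] by (simp add: f_def)
  qed
  have mono: "f A \<subseteq> f B" if "A \<subseteq> B" for A B
    using that unfolding f_def X_def Under_def Above_def by blast
  show ?thesis unfolding R_embeddable_def
  proof (intro exI conjI ballI allI impI)
    fix A assume "A \<in> Field tree"
    then have "(f A, f A) \<in> R_order k" using R[of "f A" "f A"] cut by (simp add: Field_tree)
    then show "f A \<in> Field (R_order k)" by (auto simp: Field_def)
  next
    fix A B assume "(A, B) \<in> tree \<and> A \<noteq> B"
    then have AB: "A \<in> T" "B \<in> T" "initial A B" "A \<noteq> B" by (auto simp: tree_def)
    show "(f A, f B) \<in> R_order k" unfolding R using cut[OF AB(1)] cut[OF AB(2)] mono[OF initial_subset[OF AB(3)]] by (intro conjI) simp_all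
    \<comment> \<open>\<open>b\<close> is the first element of \<open>B\<close> outside
      \<open>A\<close>, and the gap \<open>c\<close> below \<open>b\<close> bounds \<open>A\<close>.
      So \<open>b\<close> belongs to the cut of \<open>B\<close> but not to that of
      \<open>A\<close>.\<close>
    obtain b where b: "b \<in> B" "A = {x \<in> B. lt x b}" using initial_proper[OF AB(3,4) T_well_ordered[OF AB(2)]] by blast
    then obtain c where c: "lt c b" "bounded_by A c" using AB(2) unfolding nodes_def gapped_def by blast
    have "e b \<in> f B" using Xf[OF AB(2)] b by (auto simp: X_def)
    moreover have "e b \<notin> f A"
    proof
      assume "e b \<in> f A"
      then have "(e b, e c) \<in> ?Q" using bdX[OF AB(1) c(2)] unfolding f_def Under_def by blast
      then show False using iff[OF lt_Field(2,1)[OF c(1)]] lt_le_trans[OF c(1)] lt_irrefl by blast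
    qed
    ultimately show "f A \<noteq> f B" by blast
  qed
qed

text \<open>The climb starts at the empty node, so the demands at all nonzero \<open>c\<close> are
  covered. Only nodes of height below \<open>c\<close> matter for \<open>reachable\<close>, so
  \<open>T\<close> may replace the set of nodes below \<open>d\<close>.\<close>

lemma branch_avoiding:
  assumes d: "d \<in> branching" and \<xi>: "\<xi> \<in> Field k"
  shows "\<exists>A\<in>T. ht A = d \<and> (\<forall>c\<in>C d - limit_points l (C d).
    (\<exists>b. l.lt b c) \<and> reachable (D d \<xi> c) T c \<longrightarrow> (\<exists>z. initial z A \<and> z \<noteq> A \<and> D d \<xi> c z))"
proof -
  obtain b' where b': "lt q0 b'" using bounded_by_above[OF bounded_by_empty] by blast
  obtain b where "l.lt b d" using branching_pos[OF d] by blast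
  then have "l.lt (ht {}) d" using ht_empty_le l.lt_Field l.le_lt_trans by blast
  then obtain A where A: "A \<in> T" "ht A = d" "good_branch D (nodes_below P d) d {} b' \<xi> A"
    using branching_branch[OF d extendible_all T_empty _ bounded_by_empty b' \<xi>] l.lt_Field by blast
  have dF: "d \<in> Field l" using d by (simp add: branching_def)
  have "\<exists>z. initial z A \<and> z \<noteq> A \<and> D d \<xi> c z"
    if c: "c \<in> C d - limit_points l (C d)" "\<exists>b. l.lt b c" "reachable (D d \<xi> c) T c" for c
  proof -
    have "l.lt (ht {}) c" using c(2) ht_empty_le l.lt_Field l.le_lt_trans by blast
    moreover have "l.lt c d" using C_lt[OF dF] c(1) by blast
    then have "reachable (D d \<xi> c) (nodes_below P d) c"
      using c(3) l.lt_trans unfolding reachable_def nodes_below_def by blast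
    ultimately show ?thesis using A(3) c(1) unfolding good_branch_def by blast
  qed
  then show ?thesis using A by blast
qed

end

section \<open>Guessing\<close>

context heights
begin

section \<open>Levels of arbitrary trees\<close>

lemma tree_below:
  assumes t: "is_tree t" and x: "x \<in> Field t" and y: "y \<in> underS t x"
  shows "Restr (Restr t (underS t x)) (underS (Restr t (underS t x)) y) = Restr t (underS t y)"
proof -
  have "trans t" "antisym t" using t unfolding is_tree_def order_on_defs by blast+
  then have "underS t y \<subseteq> underS t x"
    using y unfolding underS_def trans_def antisym_def by blast
  then have "underS (Restr t (underS t x)) y = underS t y" using y by (auto simp: underS_def)
  then show ?thesis using \<open>underS t y \<subseteq> underS t x\<close> by auto
qed

lemma tree_Restr:
  assumes t: "is_tree t" and x: "x \<in> Field t"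
  shows "Well_order (Restr t (underS t x))" "Field (Restr t (underS t x)) = underS t x"
  using assms well_order_on_Well_order unfolding is_tree_def by blast+

lemma level_less:
  assumes t: "is_tree t" and x: "x \<in> level l t a" and y: "y \<in> level l t b" "y \<in> underS t x"
    and F: "a \<in> Field l" "b \<in> Field l"
  shows "l.lt b a"
proof (rule ccontr)
  assume "\<not> l.lt b a"
  then have ab: "a = b \<or> l.lt a b" using F l.not_lt unfolding l.lt_def by blast
  let ?r = "Restr t (underS t x)"
  have xF: "x \<in> Field t" and xa: "?r =o Restr l (underS l a)" using x by (auto simp: level_def)
  have "Restr ?r (underS ?r y) <o ?r"
    using underS_Restr_ordLess[OF tree_Restr(1)[OF t xF]] tree_Restr(2)[OF t xF] y(2) by auto
  then have "Restr t (underS t y) <o Restr l (underS l a)"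
    using tree_below[OF t xF y(2)] xa ordLess_ordIso_trans by simp
  then have *: "Restr l (underS l b) <o Restr l (underS l a)"
    using y(1) ordIso_ordLess_trans[OF ordIso_symmetric] by (auto simp: level_def)
  from ab show False
  proof
    assume "a = b" then show False using * ordLess_irreflexive by blast
  next
    assume "l.lt a b"
    then show False using ordLess_transitive[OF * underS_Restr_less] ordLess_irreflexive by blast
  qed
qed

lemma level_pred:
  assumes t: "is_tree t" and x: "x \<in> level l t a" and b: "l.lt b a"
  obtains y where "y \<in> level l t b" "y \<in> underS t x"
proof -
  let ?r = "Restr t (underS t x)"
  have xF: "x \<in> Field t" and xa: "?r =o Restr l (underS l a)" using x by (auto simp: level_def)
  have "Restr l (underS l b) <o ?r"
    using ordLess_ordIso_trans[OF underS_Restr_less[OF b] ordIso_symmetric[OF xa]] .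
  then obtain y where y: "y \<in> Field ?r" "Restr l (underS l b) =o Restr ?r (underS ?r y)"
    using ordLess_iff_ordIso_Restr[OF tree_Restr(1)[OF t xF]] wo_l Well_order_Restr by blast
  have yx: "y \<in> underS t x" using y tree_Restr(2)[OF t xF] by simp
  moreover have "y \<in> Field t" using yx by (auto simp: underS_def Field_def)
  ultimately show ?thesis
    using that[of y] y(2) tree_below[OF t xF yx] ordIso_symmetric by (auto simp: level_def)
qed

text \<open>If \<open>x\<close> went down to a level \<open>b\<close> below \<open>a\<close>, its
  predecessor on level \<open>b\<close> would go to a level strictly below \<open>b\<close>, against
  the induction hypothesis.\<close>

lemma level_increasing:
  assumes t: "is_tree t" and u: "is_tree u" and E: "E \<subseteq> Field l"
    and f: "\<And>x. x \<in> tree_restrict l t E \<Longrightarrow> f x \<in> tree_restrict l u E"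
    and mono: "\<And>x y. x \<in> tree_restrict l t E \<Longrightarrow> y \<in> tree_restrict l t E \<Longrightarrow> x \<in> underS t y \<Longrightarrow> f x \<in> underS u (f y)"
    and a: "a \<in> Field l"
  shows "a \<in> E \<Longrightarrow> b \<in> E \<Longrightarrow> x \<in> level l t a \<Longrightarrow> f x \<in> level l u b \<Longrightarrow> (a, b) \<in> l"
  using a
proof (induction a arbitrary: x b rule: l_induct)
  case (less a)
  show ?case
  proof (rule ccontr)
    assume "(a, b) \<notin> l"
    then have ba: "l.lt b a" using l.not_le less.prems less.hyps E by blast
    obtain y where y: "y \<in> level l t b" "y \<in> underS t x" using level_pred[OF t less.prems(3) ba] by blast
    have TR: "x \<in> tree_restrict l t E" "y \<in> tree_restrict l t E"
      using less.prems y unfolding tree_restrict_def by blast+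
    then obtain b' where b': "b' \<in> E" "f y \<in> level l u b'" using f unfolding tree_restrict_def by blast
    have "(b, b') \<in> l" using less.IH[OF ba less.prems(2) b'(1) y(1) b'(2)] .
    moreover have "l.lt b' b"
      using level_less[OF u less.prems(4) b'(2) mono[OF TR(2,1) y(2)]] less.prems b' E by blast
    ultimately show False using l.le_lt_trans l.lt_irrefl by blast
  qed
qed

end

context tree_setting
begin

section \<open>Enumerating small sets and countable sequences\<close>

lemma k_Cinfinite: "Cinfinite k"
  using k_inf k_card by (simp add: cinfinite_def)

text \<open>Nonempty sets of size at most \<open>k\<close> are images of functions on
  \<open>k\<close>, and \<open>(k^+)^k = (2^k)^k = 2^k = k^+\<close>.\<close>

lemma enum_small_subsets:
  assumes pow: "ctwo ^c k =o l" and N: "|N| \<le>o l"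
  shows "\<exists>p :: 'a set \<Rightarrow> 'b set. \<forall>g. g \<subseteq> N \<and> |g| \<le>o k \<longrightarrow> (\<exists>i\<in>Field l. p i = g)"
proof -
  define H where "H = insert {} ((\<lambda>h. h ` Field k) ` Func (Field k) N)"
  have "|Func (Field k) N| \<le>o l"
  proof -
    have "|Func (Field k) N| = |N| ^c k" by (simp add: cexp_def Field_card_of)
    also have "|N| ^c k \<le>o (ctwo ^c k) ^c k"
      using ordLeq_ordIso_trans[OF N ordIso_symmetric[OF pow]] k_card by (intro cexp_mono1)
    also have "(ctwo ^c k) ^c k =o ctwo ^c k"
      using cexp_cprod_ordLeq[OF Card_order_ctwo k_Cinfinite Cinfinite_Cnotzero[OF k_Cinfinite] ordLeq_refl[OF k_card]] .
    also note pow
    finally show ?thesis .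
  qed
  then have "|(\<lambda>h. h ` Field k) ` Func (Field k) N| \<le>o l" by (rule ordLeq_transitive[OF card_of_image])
  moreover have "|{{}} :: 'b set set| \<le>o l"
    by (rule ordLeq_transitive[OF ordLess_imp_ordLeq[OF finite_small] cardSuc_ordLeq[OF k_card]]) simp
  ultimately have "|{{}} \<union> (\<lambda>h. h ` Field k) ` Func (Field k) N| \<le>o l"
    using card_of_Un_ordLeq_infinite_Field[OF l_inf _ _ l_card] by blast
  then have "|H| \<le>o l" by (simp add: H_def)
  then have "|H| \<le>o |Field l|"
    by (rule ordLeq_ordIso_trans[OF _ ordIso_symmetric[OF card_of_Field_ordIso[OF l_card]]])
  moreover have "H \<noteq> {}" by (simp add: H_def)
  ultimately have "\<exists>p. p ` Field l = H" using card_of_ordLeq2[of H "Field l"] by simp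
  then obtain p where p: "p ` Field l = H" ..
  have "\<exists>i\<in>Field l. p i = g" if g: "g \<subseteq> N" "|g| \<le>o k" for g
  proof -
    have "g \<in> H"
    proof (cases "g = {}")
      case False
      have "|g| \<le>o |Field k|"
        using ordLeq_ordIso_trans[OF g(2) ordIso_symmetric[OF card_of_Field_ordIso[OF k_card]]] .
      then have "\<exists>h. h ` Field k = g" using card_of_ordLeq2[OF False, of "Field k"] by simp
      then obtain h where h: "h ` Field k = g" ..
      define h' where "h' a = (if a \<in> Field k then h a else undefined)" for a
      have "h' \<in> Func (Field k) N" using h g(1) by (auto simp: Func_def h'_def)
      moreover have "h' ` Field k = g" using h by (auto simp: h'_def)
      ultimately show ?thesis unfolding H_def by blast
    qed (simp add: H_def)
    then show ?thesis using p by auto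
  qed
  then show ?thesis by blast
qed

text \<open>As \<open>k\<close> is uncountable, \<open>small_Func\<close> counts the countable
  sequences below \<open>c\<close>. For \<open>c\<close> zero there are none.\<close>

lemma enum_sequences:
  assumes unc: "natLeq <o k" and c: "c \<in> Field l"
  shows "\<exists>s :: 'a \<Rightarrow> nat \<Rightarrow> 'a set. \<forall>i. (\<forall>n. l.lt (i n) c) \<longrightarrow> (\<exists>\<xi>\<in>Field k. s \<xi> = i)"
proof (cases "\<exists>b. l.lt b c")
  case True
  let ?F = "Func (UNIV :: nat set) (underS l c)"
  have "|UNIV :: nat set| <o k" using ordIso_ordLess_trans[OF card_of_nat unc] .
  then have F: "|?F| \<le>o k" using small_Func underS_l_small[OF c] by blast
  have "|?F| \<le>o |Field k|"
    using ordLeq_ordIso_trans[OF F ordIso_symmetric[OF card_of_Field_ordIso[OF k_card]]] .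
  moreover have "?F \<noteq> {}" using True by (auto simp: Func_def l.underS_lt)
  ultimately have "\<exists>s. s ` Field k = ?F" using card_of_ordLeq2[of ?F "Field k"] by simp
  then obtain s where "s ` Field k = ?F" ..
  moreover have "i \<in> ?F" if "\<forall>n. l.lt (i n) c" for i using that by (simp add: Func_def l.underS_lt)
  ultimately show ?thesis by (metis (no_types, lifting) image_iff)
qed blast

text \<open>
  At ordinals of countable cofinality \<open>\<kappa>\<^bsup><\<kappa>\<^esup> = \<kappa>\<close> leaves only \<open>\<kappa>\<close> candidates for
  \<open>F c\<close>, namely the countable unions of sets with codes below \<open>c\<close> (Gregory's argument for diamond).
\<close>
lemma guessing:
  fixes N :: "'b set"
  assumes pow: "ctwo ^c k =o l" and unc: "natLeq <o k" and N: "|N| \<le>o l"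
  obtains G :: "'a set \<Rightarrow> 'a \<Rightarrow> 'b set" where
    "\<And>F E. (\<And>b. b \<in> Field l \<Longrightarrow> F b \<subseteq> N \<and> |F b| \<le>o k) \<Longrightarrow>
      (\<And>b b'. (b, b') \<in> l \<Longrightarrow> F b \<subseteq> F b') \<Longrightarrow>
      (\<And>c. c \<in> Field l \<Longrightarrow> limit_ht c \<Longrightarrow> F c \<subseteq> (\<Union>b\<in>underS l c. F b)) \<Longrightarrow>
      unbounded_in l (Field l) E \<Longrightarrow>
      \<exists>\<xi>\<in>Field k. unbounded_in l (Field l)
        {c \<in> Field l. G c \<xi> = F c \<and> (\<forall>b. l.lt b c \<longrightarrow> (\<exists>g\<in>E. l.lt b g \<and> l.lt g c))}"
proof -
  obtain p :: "'a set \<Rightarrow> 'b set" where p: "\<And>g. g \<subseteq> N \<Longrightarrow> |g| \<le>o k \<Longrightarrow> \<exists>i\<in>Field l. p i = g"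
    using enum_small_subsets[OF pow N] by blast
  have "\<forall>c. \<exists>s :: 'a \<Rightarrow> nat \<Rightarrow> 'a set. c \<in> Field l \<longrightarrow> (\<forall>i. (\<forall>n. l.lt (i n) c) \<longrightarrow> (\<exists>\<xi>\<in>Field k. s \<xi> = i))"
    using enum_sequences[OF unc] by blast
  then obtain s :: "'a set \<Rightarrow> 'a \<Rightarrow> nat \<Rightarrow> 'a set" where
    s: "\<And>c i. c \<in> Field l \<Longrightarrow> (\<And>n. l.lt (i n) c) \<Longrightarrow> \<exists>\<xi>\<in>Field k. s c \<xi> = i" by metis
  \<comment> \<open>As \<open>\<xi>\<close> runs through \<open>k\<close>, all countable sequences
    of codes below \<open>c\<close> occur as \<open>s c \<xi>\<close>; the guess is the union of the
    coded sets.\<close>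
  define G where "G c \<xi> = (\<Union>n. p (s c \<xi> n))" for c \<xi>
  show ?thesis
  proof (rule that[of G])
    fix F E
    assume F: "\<And>b. b \<in> Field l \<Longrightarrow> F b \<subseteq> N \<and> |F b| \<le>o k" and mono: "\<And>b b'. (b, b') \<in> l \<Longrightarrow> F b \<subseteq> F b'"
      and cont: "\<And>c. c \<in> Field l \<Longrightarrow> limit_ht c \<Longrightarrow> F c \<subseteq> (\<Union>b\<in>underS l c. F b)"
      and E: "unbounded_in l (Field l) E"
    define X where "X \<xi> = {c \<in> Field l. G c \<xi> = F c \<and> (\<forall>b. l.lt b c \<longrightarrow> (\<exists>g\<in>E. l.lt b g \<and> l.lt g c))}" for \<xi>
    have ex: "\<exists>\<xi>\<in>Field k. \<exists>c\<in>X \<xi>. l.lt a c" if a: "a \<in> Field l" for a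
    proof -
      have "\<exists>i. b \<in> Field l \<longrightarrow> i \<in> Field l \<and> p i = F b" for b using p[of "F b"] F[of b] by blast
      then obtain code where code: "\<And>b. b \<in> Field l \<Longrightarrow> code b \<in> Field l \<and> p (code b) = F b" by metis
      \<comment> \<open>\<open>nx b\<close> will lie beyond \<open>b\<close>, beyond the code of
        \<open>F b\<close> and beyond an element of \<open>E\<close> past \<open>b\<close>.
        Iterating it countably often leads up to a \<open>c\<close> below which all these codes
        occur.\<close>
      have "\<exists>m. b \<in> Field l \<longrightarrow> l.lt b m \<and> l.lt (code b) m \<and> (\<exists>g\<in>E. l.lt b g \<and> l.lt g m)" for b
      proof (cases "b \<in> Field l")
        case b: True
        obtain b' where b': "l.lt b b'" using l_no_max[OF b] by blast
        then obtain g where g: "g \<in> E" "(b', g) \<in> l" using E l.lt_Field unfolding unbounded_in_def by blast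
        have "{b, code b, g} \<subseteq> Field l" using b code[OF b] g l.le_Field by blast
        moreover have "|{b, code b, g}| \<le>o k" by (intro ordLess_imp_ordLeq finite_small) simp
        ultimately obtain m where "\<forall>x\<in>{b, code b, g}. l.lt x m" using l_sup by blast
        then show ?thesis using g l.lt_le_trans[OF b'] by blast
      qed blast
      then obtain nx where nx: "\<And>b. b \<in> Field l \<Longrightarrow> l.lt b (nx b) \<and> l.lt (code b) (nx b) \<and> (\<exists>g\<in>E. l.lt b g \<and> l.lt g (nx b))"
        by metis
      define r where "r n = (nx ^^ n) a" for n :: nat
      have rS: "r (Suc n) = nx (r n)" for n by (simp add: r_def)
      have rF: "r n \<in> Field l" for n
      proof (induction n)
        case 0 then show ?case using a by (simp add: r_def)
      next
        case (Suc n) then show ?case using nx l.lt_Field rS by metis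
      qed
      have "|range r| \<le>o k"
        using ordLeq_transitive[OF card_of_image ordLess_imp_ordLeq[OF ordIso_ordLess_trans[OF card_of_nat unc]]] .
      then have ne: "{m \<in> Field l. \<forall>n. l.lt (r n) m} \<noteq> {}"
        using l_sup[of "range r"] rF by blast
      obtain c where c: "c \<in> Field l" "\<And>n. l.lt (r n) c"
        and cl: "\<And>m. m \<in> Field l \<Longrightarrow> (\<And>n. l.lt (r n) m) \<Longrightarrow> (c, m) \<in> l"
        using l_least[OF _ ne] by blast
      have cof: "\<exists>n. (b, r n) \<in> l" if b: "l.lt b c" for b
      proof (rule ccontr)
        assume "\<not> ?thesis"
        then have "l.lt (r n) b" for n using l.not_le rF l.lt_Field[OF b] by blast
        then have "(c, b) \<in> l" using cl l.lt_Field[OF b] by blast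
        then show False using b l.lt_le_trans l.lt_irrefl by blast
      qed
      have "limit_ht c" unfolding limit_ht_def
      proof (intro allI impI)
        fix b assume "l.lt b c"
        then obtain n where "(b, r n) \<in> l" using cof by blast
        then have "l.lt b (r (Suc n))" using nx[OF rF[of n]] rS l.le_lt_trans by simp
        then show "\<exists>b'. l.lt b b' \<and> l.lt b' c" using c by blast
      qed
      have "F c = (\<Union>n. F (r n))"
      proof
        show "F c \<subseteq> (\<Union>n. F (r n))"
        proof
          fix x assume "x \<in> F c"
          then obtain b where b: "l.lt b c" "x \<in> F b" using cont[OF c(1) \<open>limit_ht c\<close>] unfolding l.underS_lt by blast
          obtain n where "(b, r n) \<in> l" using cof[OF b(1)] by blast
          then show "x \<in> (\<Union>n. F (r n))" using mono b by blast
        qed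
        show "(\<Union>n. F (r n)) \<subseteq> F c" using mono[OF l.lt_le[OF c(2)]] by blast
      qed
      moreover have "\<exists>\<xi>\<in>Field k. s c \<xi> = (\<lambda>n. code (r n))"
      proof (rule s[OF c(1)])
        fix n show "l.lt (code (r n)) c" using nx[OF rF[of n]] c(2)[of "Suc n"] rS l.lt_trans by metis
      qed
      ultimately obtain \<xi> where \<xi>: "\<xi> \<in> Field k" "G c \<xi> = F c" using code[OF rF] by (auto simp: G_def)
      have "\<exists>g\<in>E. l.lt b g \<and> l.lt g c" if b: "l.lt b c" for b
      proof -
        obtain n where n: "(b, r n) \<in> l" using cof[OF b] by blast
        obtain g where "g \<in> E" "l.lt (r n) g" "l.lt g (r (Suc n))" using nx[OF rF[of n]] rS by auto
        then show ?thesis using l.le_lt_trans[OF n] l.lt_trans[OF _ c(2)] by blast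
      qed
      then have "c \<in> X \<xi>" using \<xi> c by (simp add: X_def)
      moreover have "l.lt a c" using c(2)[of 0] by (simp add: r_def)
      ultimately show ?thesis using \<xi> by blast
    qed
    \<comment> \<open>Pigeonhole: if each of the \<open>k\<close> indices were right only below some
      bound, these bounds would have a common bound in \<open>l\<close>, beyond which no index is
      right.\<close>
    have "\<exists>\<xi>\<in>Field k. unbounded_in l (Field l) (X \<xi>)"
    proof (rule ccontr)
      assume neg: "\<not> ?thesis"
      have XF: "X \<xi> \<subseteq> Field l" for \<xi> by (auto simp: X_def)
      have "\<exists>b. \<xi> \<in> Field k \<longrightarrow> b \<in> Field l \<and> (\<forall>c\<in>X \<xi>. (b, c) \<notin> l)" for \<xi>
        using neg XF unfolding unbounded_in_def by blast
      then obtain b where b: "\<And>\<xi>. \<xi> \<in> Field k \<Longrightarrow> b \<xi> \<in> Field l \<and> (\<forall>c\<in>X \<xi>. (b \<xi>, c) \<notin> l)" by metis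
      have "b ` Field k \<subseteq> Field l" using b by blast
      then obtain m where m: "m \<in> Field l" "\<forall>x\<in>b ` Field k. l.lt x m"
        using l_sup[of "b ` Field k"] image_le[OF Field_k] by blast
      then obtain \<xi> c where "\<xi> \<in> Field k" "c \<in> X \<xi>" "l.lt m c" using ex by blast
      moreover have "l.lt (b \<xi>) m" using m \<open>\<xi> \<in> Field k\<close> by blast
      ultimately show False using b[of \<xi>] l.lt_trans l.lt_le by blast
    qed
    then show "\<exists>\<xi>\<in>Field k. unbounded_in l (Field l)
        {c \<in> Field l. G c \<xi> = F c \<and> (\<forall>b. l.lt b c \<longrightarrow> (\<exists>g\<in>E. l.lt b g \<and> l.lt g c))}"
      unfolding X_def .
  qed
qed

end

section \<open>Avoiding club isomorphisms\<close>

lemma is_tree_chain: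
  assumes t: "is_tree t" and a: "(a, y) \<in> t" and b: "(b, y) \<in> t"
  shows "(a, b) \<in> t \<or> (b, a) \<in> t"
proof (cases "a = y \<or> b = y")
  case False
  have y: "y \<in> Field t" using a by (auto simp: Field_def)
  let ?r = "Restr t (underS t y)"
  have ab: "a \<in> underS t y" "b \<in> underS t y" using False a b by (auto simp: underS_def)
  have "well_order_on (underS t y) ?r" using t y by (simp add: is_tree_def)
  then have "refl_on (underS t y) ?r" "total_on (underS t y) ?r" by (auto simp: order_on_defs)
  then show ?thesis using ab unfolding refl_on_def total_on_def by (cases "a = b") auto
qed (use a b in auto)

context tree_family
begin

lemma nodes_below_small:
  assumes "a \<in> Field l"
  shows "|nodes_below P a| \<le>o k"
proof -
  have "nodes_below P a = (\<Union>b\<in>underS l a. {A \<in> T. ht A = b})"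
    by (auto simp: nodes_below_def l.underS_lt)
  then show ?thesis
    using UN_le[OF underS_l_small[OF assms], of "\<lambda>b. {A \<in> T. ht A = b}"] level_small l.lt_Field
    by (simp add: l.underS_lt)
qed

text \<open>
  A node \<open>w\<close> has \<open>\<kappa>\<close> many pairwise incomparable extensions of a common height in \<open>E\<close>, and each
  element of \<open>Y\<close> is above the image of at most one of them.
\<close>
lemma reachable_avoiding:
  assumes u: "is_tree u" and Y: "|Y| <o k"
    and emb: "\<And>x y. x \<in> T \<Longrightarrow> y \<in> T \<Longrightarrow> ht x \<in> E \<Longrightarrow> ht y \<in> E \<Longrightarrow> (f x, f y) \<in> u \<Longrightarrow> initial x y"
    and c: "\<And>b. l.lt b c \<Longrightarrow> \<exists>g\<in>E. l.lt b g \<and> l.lt g c"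
  shows "reachable (\<lambda>z. z \<in> T \<and> ht z \<in> E \<and> l.lt (ht z) c \<and> (\<forall>y\<in>Y. (f z, y) \<notin> u)) T c"
  unfolding reachable_def
proof (intro ballI impI allI)
  fix w b b' assume w: "w \<in> T" "l.lt (ht w) c" and b: "bounded_by w b \<and> lt b b'"
  obtain g where g: "g \<in> E" "l.lt (ht w) g" "l.lt g c" using c[OF w(2)] by blast
  \<comment> \<open>The subintervals supply \<open>k\<close> different points \<open>s i\<close> to
    put on top of \<open>w\<close>, each with space left below \<open>b'\<close>.\<close>
  obtain p s where ps: "\<And>i. i \<in> Field k \<Longrightarrow> (b, p i) \<in> q \<and> lt (p i) (s i) \<and> lt (s i) b'"
      "\<And>i j. K.lt i j \<Longrightarrow> (s i, p j) \<in> q"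
    using q_interval[of b b'] b unfolding lt_def K.lt_def by metis
  have bs: "lt b (s i)" if "i \<in> Field k" for i using ps(1)[OF that] le_lt_trans by blast
  have "\<exists>z. i \<in> Field k \<longrightarrow> z \<in> T \<and> ht z = g \<and> initial (insert (s i) w) z \<and> bounded_by z b'" for i
  proof (cases "i \<in> Field k")
    case i: True
    note I = T_insert[OF w(1) conjunct1[OF b] bs[OF i]]
    have "\<not> l.lt g (ht (insert (s i) w))" using I(6) g(2) l.lt_le_trans l.lt_irrefl by blast
    then have "(ht (insert (s i) w), g) \<in> l"
      using l.not_lt[OF l.lt_Field(1)[OF g(3)] ht_Field[OF T_well_ordered[OF I(1)]]] by blast
    then show ?thesis using extend[OF I(1) _ I(2)] ps(1)[OF i] by blast
  qed blast
  then obtain z where z: "\<And>i. i \<in> Field k \<Longrightarrow> z i \<in> T \<and> ht (z i) = g \<and> initial (insert (s i) w) (z i) \<and> bounded_by (z i) b'"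
    by metis
  \<comment> \<open>Comparable extensions coincide, since both have height \<open>g\<close>; then
    their first elements beyond \<open>w\<close>, which are \<open>s i\<close> and
    \<open>s j\<close>, agree.\<close>
  have zinj: "i = j" if ij: "i \<in> Field k" "j \<in> Field k" and le: "initial (z i) (z j)" for i j
  proof -
    have "z i = z j" using ht_less[OF T_well_ordered le] z[OF ij(1)] z[OF ij(2)] l.lt_irrefl by auto
    then have "initial (insert (s i) w) (z j)" "initial (insert (s j) w) (z j)" using z[OF ij(1)] z[OF ij(2)] by auto
    then have "initial (insert (s i) w) (insert (s j) w) \<or> initial (insert (s j) w) (insert (s i) w)"
      using initial_comparable well_orderedD[OF T_well_ordered] z[OF ij(2)] by blast
    then have "s i \<in> insert (s j) w \<or> s j \<in> insert (s i) w" unfolding initial_def by blast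
    then have "s i = s j"
      using T_insert(4)[OF w(1) conjunct1[OF b] bs[OF ij(1)]] T_insert(4)[OF w(1) conjunct1[OF b] bs[OF ij(2)]] by auto
    moreover have "lt (s i) (s j)" if "K.lt i j" "j \<in> Field k" for i j
      using ps(2)[OF that(1)] ps(1)[OF that(2)] le_lt_trans by blast
    ultimately show "i = j" using K.le_total[OF ij] ij lt_irrefl unfolding K.lt_def by metis
  qed
  have "\<exists>i\<in>Field k. \<forall>y\<in>Y. (f (z i), y) \<notin> u"
  proof (rule ccontr)
    assume "\<not> ?thesis"
    then have "\<exists>y. i \<in> Field k \<longrightarrow> y \<in> Y \<and> (f (z i), y) \<in> u" for i by blast
    then obtain h where h: "\<And>i. i \<in> Field k \<Longrightarrow> h i \<in> Y \<and> (f (z i), h i) \<in> u" by metis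
    \<comment> \<open>Images below the same element of \<open>u\<close> are comparable, hence so are
      the nodes, so each \<open>y\<close> rules out at most one index.\<close>
    have "inj_on h (Field k)"
    proof (rule inj_onI)
      fix i j assume ij: "i \<in> Field k" "j \<in> Field k" "h i = h j"
      then have "(f (z i), f (z j)) \<in> u \<or> (f (z j), f (z i)) \<in> u"
        using is_tree_chain[OF u] h by metis
      then have "initial (z i) (z j) \<or> initial (z j) (z i)" using emb z ij g by auto
      then show "i = j" using zinj ij by blast
    qed
    moreover have "h ` Field k \<subseteq> Y" using h by blast
    ultimately have "|Field k| \<le>o |Y|" using card_of_ordLeq by blast
    then show False
      using Y ordIso_ordLeq_trans[OF ordIso_symmetric[OF card_of_Field_ordIso[OF k_card]]] not_ordLess_ordLeq by blast
  qed
  then obtain i where i: "i \<in> Field k" "\<forall>y\<in>Y. (f (z i), y) \<notin> u" by blast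
  then show "\<exists>z\<in>T. l.lt (ht z) c \<and> initial w z \<and> bounded_by z b' \<and>
      (z \<in> T \<and> ht z \<in> E \<and> l.lt (ht z) c \<and> (\<forall>y\<in>Y. (f z, y) \<notin> u))"
    using z[OF i(1)] g initial_trans[OF T_insert(3)[OF w(1) conjunct1[OF b] bs[OF i(1)]]]
    by (intro bexI[of _ "z i"]) auto
qed

text \<open>\<open>r d\<close> ranks level \<open>d\<close> of \<open>u\<close> along
  \<open>C d\<close>, and \<open>D\<close> demands a node whose guessed image is below no node
  ranked before \<open>c\<close>. The image of the branch for the right index has a rank in
  \<open>C d\<close> and is ruled out at a correct guess beyond this rank.\<close>

lemma not_club_isomorphic:
  fixes u :: "'a set rel" and G :: "'a set \<Rightarrow> 'a \<Rightarrow> ('a set \<times> 'a set) set"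
  assumes u: "lambda_tree l u"
    and G: "\<And>F E. (\<And>b. b \<in> Field l \<Longrightarrow> F b \<subseteq> Pow (Field q) \<times> Field u \<and> |F b| \<le>o k) \<Longrightarrow>
      (\<And>b b'. (b, b') \<in> l \<Longrightarrow> F b \<subseteq> F b') \<Longrightarrow>
      (\<And>c. c \<in> Field l \<Longrightarrow> limit_ht c \<Longrightarrow> F c \<subseteq> (\<Union>b\<in>underS l c. F b)) \<Longrightarrow>
      unbounded_in l (Field l) E \<Longrightarrow>
      \<exists>\<xi>\<in>Field k. unbounded_in l (Field l)
        {c \<in> Field l. G c \<xi> = F c \<and> (\<forall>b. l.lt b c \<longrightarrow> (\<exists>g\<in>E. l.lt b g \<and> l.lt g c))}"
    and r: "\<And>d. d \<in> branching \<Longrightarrow> inj_on (r d) (level l u d) \<and> r d ` level l u d \<subseteq> C d"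
    and D: "\<And>d \<xi> c z. D d \<xi> c z \<longleftrightarrow> (\<exists>v. (z, v) \<in> G c \<xi> \<and> (\<forall>y\<in>level l u d. l.lt (r d y) c \<longrightarrow> (v, y) \<notin> u))"
    and box: "\<And>X. unbounded_in l (Field l) X \<Longrightarrow>
      stationary l {d \<in> cof_points l k. unbounded_in l (underS l d) ((C d \<inter> X) - limit_points l (C d))}"
  shows "\<not> club_isomorphic l tree u"
proof
  assume "club_isomorphic l tree u"
  then obtain E f where club: "club_in l (Field l) E"
    and bij: "bij_betw f (tree_restrict l tree E) (tree_restrict l u E)"
    and iso: "\<And>x y. x \<in> tree_restrict l tree E \<Longrightarrow> y \<in> tree_restrict l tree E \<Longrightarrow> (x, y) \<in> tree \<longleftrightarrow> (f x, f y) \<in> u"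
    unfolding club_isomorphic_def by blast
  have Eu: "unbounded_in l (Field l) E" and EF: "E \<subseteq> Field l"
    using club unfolding club_in_def unbounded_in_def by blast+
  have TR: "tree_restrict l tree E = {A \<in> T. ht A \<in> E}"
    using level_tree EF unfolding tree_restrict_def by auto
  have ut: "is_tree u" using u by (simp add: lambda_tree_def)
  have po: "antisym u" "antisym tree" using ut is_tree_tree by (auto simp: is_tree_def order_on_defs)
  have f1: "f x \<in> tree_restrict l u E" if "x \<in> tree_restrict l tree E" for x
    using bij that by (auto simp: bij_betw_def)
  have inj: "inj_on f (tree_restrict l tree E)" using bij by (simp add: bij_betw_def)
  define g where "g = inv_into (tree_restrict l tree E) f"
  have g1: "g y \<in> tree_restrict l tree E" "f (g y) = y" if "y \<in> tree_restrict l u E" for y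
    using bij_betwE[OF bij_betw_inv_into[OF bij]] bij_betw_inv_into_right[OF bij that] that by (auto simp: g_def)
  have g2: "g (f x) = x" if "x \<in> tree_restrict l tree E" for x
    using bij_betw_inv_into_left[OF bij that] by (simp add: g_def)
  \<comment> \<open>Neither \<open>f\<close> nor its inverse can lower a height.\<close>
  have fht: "f x \<in> level l u (ht x)" if x: "x \<in> T" "ht x \<in> E" for x
  proof -
    have xR: "x \<in> tree_restrict l tree E" using x TR by simp
    then obtain b where b: "b \<in> E" "f x \<in> level l u b" using f1 unfolding tree_restrict_def by blast
    have xl: "x \<in> level l tree (ht x)" using level_tree x EF by auto
    have "(ht x, b) \<in> l"
    proof (rule level_increasing[OF is_tree_tree ut EF f1])
      show "f x \<in> underS u (f y)" if "x \<in> tree_restrict l tree E" "y \<in> tree_restrict l tree E" "x \<in> underS tree y" for x y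
        using iso[OF that(1,2)] that(3) inj_on_eq_iff[OF inj that(1,2)] by (simp add: underS_def)
    qed (use x b xl EF in auto)
    moreover have "(b, ht x) \<in> l"
    proof (rule level_increasing[OF ut is_tree_tree EF g1(1)])
      show "g x \<in> underS tree (g y)" if xy: "x \<in> tree_restrict l u E" "y \<in> tree_restrict l u E" "x \<in> underS u y" for x y
      proof -
        have "(g x, g y) \<in> tree" using iso[OF g1(1)[OF that(1)] g1(1)[OF that(2)]]
            that(3) unfolding g1(2)[OF that(1)] g1(2)[OF that(2)] underS_def by blast
        moreover have "x = y" if "g x = g y"
          using arg_cong[OF that, of f] unfolding g1(2)[OF xy(1)] g1(2)[OF xy(2)] .
        then have "g x \<noteq> g y" using xy(3) by (auto simp: underS_def)
        ultimately show ?thesis by (simp add: underS_def)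
      qed
      show "g (f x) \<in> level l tree (ht x)" using xl g2[OF xR] by simp
    qed (use x b EF in auto)
    ultimately show ?thesis using b l.le_antisym by metis
  qed
  \<comment> \<open>The object to be guessed is the graph of \<open>f\<close> on the nodes of height
    below \<open>b\<close>.\<close>
  define F where "F b = {(z, f z) | z. z \<in> T \<and> ht z \<in> E \<and> l.lt (ht z) b}" for b
  have "\<exists>\<xi>\<in>Field k. unbounded_in l (Field l)
        {c \<in> Field l. G c \<xi> = F c \<and> (\<forall>b. l.lt b c \<longrightarrow> (\<exists>g\<in>E. l.lt b g \<and> l.lt g c))}"
  proof (rule G[OF _ _ _ Eu])
    fix b assume b: "b \<in> Field l"
    have "F b \<subseteq> (\<lambda>z. (z, f z)) ` nodes_below P b" by (auto simp: F_def nodes_below_def)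
    then have "|F b| \<le>o k"
      using ordLeq_transitive[OF card_of_mono1 image_le[OF nodes_below_small[OF b]]] by blast
    moreover have "F b \<subseteq> Pow (Field q) \<times> Field u"
      using well_orderedD[OF T_well_ordered] fht unfolding F_def level_def by blast
    ultimately show "F b \<subseteq> Pow (Field q) \<times> Field u \<and> |F b| \<le>o k" by blast
  next
    show "F b \<subseteq> F b'" if "(b, b') \<in> l" for b b'
      using l.lt_le_trans[OF _ that] unfolding F_def by blast
    show "F c \<subseteq> (\<Union>b\<in>underS l c. F b)" if "c \<in> Field l" "limit_ht c" for c
      using that(2) unfolding F_def limit_ht_def l.underS_lt by blast
  qed
  then obtain \<xi> where \<xi>: "\<xi> \<in> Field k" and X: "unbounded_in l (Field l)
        {c \<in> Field l. G c \<xi> = F c \<and> (\<forall>b. l.lt b c \<longrightarrow> (\<exists>g\<in>E. l.lt b g \<and> l.lt g c))}" (is "unbounded_in _ _ ?X")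
    by blast
  obtain d where d: "d \<in> E" "d \<in> cof_points l k"
    and dX: "unbounded_in l (underS l d) ((C d \<inter> ?X) - limit_points l (C d))"
    using box[OF X] club unfolding stationary_def by blast
  have dF: "d \<in> Field l" using d EF by blast
  \<comment> \<open>Cofinality \<open>k\<close> forces \<open>C d\<close> to have order type
    \<open>k\<close>, so branches are chosen on level \<open>d\<close>.\<close>
  have "k \<le>o Restr l (C d)" using d(2) C_unbounded[OF dF] unfolding cof_points_def by blast
  then have dbig: "d \<in> branching" using C_type[OF dF] dF ordIso_iff_ordLeq unfolding branching_def by blast
  obtain A where A: "A \<in> T" "ht A = d"
    and av: "\<And>c. c \<in> C d - limit_points l (C d) \<Longrightarrow> \<exists>b. l.lt b c \<Longrightarrow> reachable (D d \<xi> c) T c \<Longrightarrow>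
      \<exists>z. initial z A \<and> z \<noteq> A \<and> D d \<xi> c z"
    using branch_avoiding[OF dbig \<xi>] by blast
  have y: "f A \<in> level l u d" using fht[of A] A d by simp
  then have "r d (f A) \<in> C d" using r[OF dbig] by blast
  then have "l.lt (r d (f A)) d" using C_lt[OF dF] by blast
  \<comment> \<open>\<open>unbounded_in\<close> only provides a \<open>c\<close> at or above a given
    element, so \<open>b\<close> is inserted to get \<open>c\<close> strictly above the
    rank.\<close>
  then obtain b where b: "l.lt (r d (f A)) b" "l.lt b d" using branching_lim[OF dbig] unfolding limit_ht_def by blast
  then obtain c where c: "c \<in> (C d \<inter> ?X) - limit_points l (C d)" "(b, c) \<in> l"
    using dX unfolding unbounded_in_def l.underS_lt by blast
  have rc: "l.lt (r d (f A)) c" using l.lt_le_trans[OF b(1) c(2)] .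
  \<comment> \<open>Fewer than \<open>k\<close> nodes are ranked before \<open>c\<close>, because
    fewer than \<open>k\<close> elements of \<open>C d\<close> precede \<open>c\<close>.\<close>
  define Y where "Y = {y \<in> level l u d. l.lt (r d y) c}"
  have Ys: "|Y| <o k"
  proof -
    obtain e where e: "\<And>c. c \<in> C d \<Longrightarrow> e c \<in> Field k" "\<And>c c'. c \<in> C d \<Longrightarrow> c' \<in> C d \<Longrightarrow> l.lt c c' \<Longrightarrow> K.lt (e c) (e c')"
      using C_rank[OF dF] by blast
    have rC: "r d y \<in> C d" if "y \<in> Y" for y using that r[OF dbig] by (auto simp: Y_def)
    have "inj_on (\<lambda>y. e (r d y)) Y"
    proof (rule inj_onI)
      fix y1 y2 assume y12: "y1 \<in> Y" "y2 \<in> Y" "e (r d y1) = e (r d y2)"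
      have "\<not> l.lt (r d y1) (r d y2)" "\<not> l.lt (r d y2) (r d y1)"
        using e(2) rC y12 K.lt_irrefl by metis+
      then have "r d y1 = r d y2"
        using l.le_total[of "r d y1" "r d y2"] C_Field[OF dF] rC y12 unfolding l.lt_def by blast
      moreover have "inj_on (r d) (level l u d)" using r[OF dbig] by blast
      ultimately show "y1 = y2" using y12 by (auto simp: Y_def dest: inj_onD)
    qed
    moreover have "(\<lambda>y. e (r d y)) ` Y \<subseteq> underS k (e c)"
      using e(2) rC c(1) unfolding K.underS_lt Y_def by blast
    ultimately have "|Y| \<le>o |underS k (e c)|" using card_of_ordLeq by blast
    moreover have "|underS k (e c)| <o k" using underS_k_small e(1) c(1) by blast
    ultimately show ?thesis using ordLeq_ordLess_trans by blast
  qed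
  have cX: "G c \<xi> = F c" "\<And>b. l.lt b c \<Longrightarrow> \<exists>g\<in>E. l.lt b g \<and> l.lt g c" using c by auto
  \<comment> \<open>The guess at \<open>c\<close> is correct, so the demand speaks about the true
    images under \<open>f\<close>.\<close>
  have "D d \<xi> c = (\<lambda>z. z \<in> T \<and> ht z \<in> E \<and> l.lt (ht z) c \<and> (\<forall>y\<in>Y. (f z, y) \<notin> u))"
    unfolding D cX(1) by (rule ext) (auto simp: F_def Y_def)
  moreover have "reachable (\<lambda>z. z \<in> T \<and> ht z \<in> E \<and> l.lt (ht z) c \<and> (\<forall>y\<in>Y. (f z, y) \<notin> u)) T c"
  proof (rule reachable_avoiding[OF ut Ys _ cX(2)])
    show "initial x y" if "x \<in> T" "y \<in> T" "ht x \<in> E" "ht y \<in> E" "(f x, f y) \<in> u" for x y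
      using iso[of x y] that TR by (simp add: tree_def)
  qed
  ultimately obtain z where z: "initial z A" "z \<in> T" "ht z \<in> E" "\<forall>y\<in>Y. (f z, y) \<notin> u"
    using av[of c] c(1) rc by auto
  \<comment> \<open>\<open>z\<close> is below \<open>A\<close>, so \<open>f z\<close> is below
    \<open>f A\<close>, although \<open>f A\<close> is one of the nodes that were avoided.\<close>
  have "(z, A) \<in> tree" using z A by (simp add: tree_def)
  then have "(f z, f A) \<in> u" using iso[of z A] z A d TR by simp
  moreover have "f A \<in> Y" using y rc by (simp add: Y_def)
  ultimately show False using z by blast
qed

end

section \<open>The linear order \<open>\<rat>\<^sub>\<kappa>\<close>\<close>

context regular_cardinal
begin

lemma k_least: "X \<subseteq> Field k \<Longrightarrow> X \<noteq> {} \<Longrightarrow> \<exists>m\<in>X. \<forall>x\<in>X. (m, x) \<in> k"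
  using K.well_ordered_least[of "Field k" X] k_Well by (simp add: K.well_ordered_def Restr_Field)

definition Qlt :: "('a \<Rightarrow> bool) \<Rightarrow> ('a \<Rightarrow> bool) \<Rightarrow> bool" where
  "Qlt f g \<longleftrightarrow> (\<exists>a\<in>Field k. (\<forall>b. K.lt b a \<longrightarrow> f b = g b) \<and> \<not> f a \<and> g a)"

lemma Q_order_iff: "(f, g) \<in> Q_order k \<longleftrightarrow> f \<in> Q_carrier k \<and> g \<in> Q_carrier k \<and> (f = g \<or> Qlt f g)"
  by (auto simp: Q_order_def Qlt_def K.underS_lt)

lemma Qlt_irrefl: "\<not> Qlt f f"
  by (auto simp: Qlt_def)

lemma Qlt_trans:
  assumes "Qlt f g" "Qlt g h" shows "Qlt f h"
proof -
  obtain a where a: "a \<in> Field k" "\<And>b. K.lt b a \<Longrightarrow> f b = g b" "\<not> f a" "g a"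
    using assms(1) unfolding Qlt_def by blast
  obtain c where c: "c \<in> Field k" "\<And>b. K.lt b c \<Longrightarrow> g b = h b" "\<not> g c" "h c"
    using assms(2) unfolding Qlt_def by blast
  consider "K.lt a c" | "K.lt c a" using K.le_total[OF a(1) c(1)] a c unfolding K.lt_def by metis
  then show ?thesis
  proof cases
    case 1
    then have "\<forall>b. K.lt b a \<longrightarrow> f b = h b" using a(2) c(2) K.lt_trans by blast
    then show ?thesis using a c(2)[OF 1] unfolding Qlt_def by blast
  next
    case 2
    then have "\<forall>b. K.lt b c \<longrightarrow> f b = h b" using a(2) c(2) K.lt_trans by blast
    then show ?thesis using c a(2)[OF 2] unfolding Qlt_def by blast
  qed
qed

text \<open>The least argument of difference decides; outside the field of \<open>k\<close> both
  functions take the default value of \<open>Func\<close>.\<close>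

lemma Qlt_total:
  assumes "f \<in> Q_carrier k" "g \<in> Q_carrier k"
  shows "f = g \<or> Qlt f g \<or> Qlt g f"
proof (cases "\<exists>a\<in>Field k. f a \<noteq> g a")
  case True
  then obtain a where a: "a \<in> {a \<in> Field k. f a \<noteq> g a}" "\<forall>x\<in>{a \<in> Field k. f a \<noteq> g a}. (a, x) \<in> k"
    using k_least[of "{a \<in> Field k. f a \<noteq> g a}"] by blast
  have "f b = g b" if "K.lt b a" for b
    using a(2) that K.lt_Field[OF that] K.le_lt_trans K.lt_irrefl by blast
  moreover have "\<not> f a \<and> g a \<or> \<not> g a \<and> f a" "a \<in> Field k" using a(1) by auto
  ultimately show ?thesis unfolding Qlt_def by (metis (no_types, lifting))
next
  case False
  have "f x = g x" for x
    using False assms by (cases "x \<in> Field k") (auto simp: Q_carrier_def Func_def)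
  then show ?thesis by blast
qed

lemma Field_Q_order: "Field (Q_order k) = Q_carrier k"
  by (auto simp: Field_def Q_order_iff)

text \<open>The function with support \<open>S\<close>, with the value outside the field that
  \<open>Func\<close> prescribes.\<close>

definition Qfun :: "'a set \<Rightarrow> 'a \<Rightarrow> bool" where
  "Qfun S a = (if a \<in> Field k then a \<in> S else undefined)"

lemma Qfun_apply: "a \<in> Field k \<Longrightarrow> Qfun S a \<longleftrightarrow> a \<in> S"
  by (simp add: Qfun_def)

lemma Qfun_carrier: "S \<subseteq> Field k \<Longrightarrow> S \<noteq> {} \<Longrightarrow> |S| <o k \<Longrightarrow> Qfun S \<in> Q_carrier k"
proof -
  assume S: "S \<subseteq> Field k" "S \<noteq> {}" "|S| <o k"
  have "{a \<in> Field k. Qfun S a} = S" using S(1) by (auto simp: Qfun_def)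
  moreover have "Qfun S \<in> Func (Field k) UNIV" by (simp add: Func_def Qfun_def)
  ultimately show ?thesis using S unfolding Q_carrier_def mem_Collect_eq by metis
qed

lemma Q_bound:
  assumes "f \<in> Q_carrier k"
  obtains m where "m \<in> Field k" "\<And>a. a \<in> Field k \<Longrightarrow> f a \<Longrightarrow> K.lt a m"
  using k_sup[of "{a \<in> Field k. f a}"] assms unfolding Q_carrier_def by blast

lemma Un_small: "|A| <o k \<Longrightarrow> |B| <o k \<Longrightarrow> |A \<union> B| <o k"
  using card_of_Un_ordLess_infinite_Field[OF k_inf k_card] by blast

text \<open>Every \<open>f\<close> has a zero \<open>z f\<close>, since its support is bounded. The
  bound takes the value 1 up to and including an \<open>m\<close> beyond all these zeros, so it
  exceeds \<open>f\<close> at the first zero of \<open>f\<close>.\<close>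

lemma Q_bounded:
  assumes A: "A \<subseteq> Q_carrier k" "|A| <o k"
  shows "\<exists>g\<in>Q_carrier k. \<forall>f\<in>A. Qlt f g"
proof -
  have "\<exists>z. f \<in> A \<longrightarrow> z \<in> Field k \<and> \<not> f z" for f
  proof (cases "f \<in> A")
    case True
    then have "f \<in> Q_carrier k" using A(1) by blast
    then obtain m where "m \<in> Field k" "\<And>a. a \<in> Field k \<Longrightarrow> f a \<Longrightarrow> K.lt a m" by (rule Q_bound) blast
    then show ?thesis using K.lt_irrefl by blast
  qed blast
  then obtain z where z: "\<And>f. f \<in> A \<Longrightarrow> z f \<in> Field k \<and> \<not> f (z f)" by metis
  have "z ` A \<subseteq> Field k" using z by blast
  moreover have "|z ` A| <o k" using A(2) by (rule image_small)
  ultimately obtain m where m: "m \<in> Field k" "\<And>f. f \<in> A \<Longrightarrow> K.lt (z f) m"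
    using k_sup[of "z ` A"] by blast
  define S where "S = insert m (underS k m)"
  have S: "S \<subseteq> Field k" "S \<noteq> {}" "|S| <o k"
    using m(1) K.lt_Field insert_small[OF underS_k_small[OF m(1)]] by (auto simp: S_def K.underS_lt)
  have "Qlt f (Qfun S)" if f: "f \<in> A" for f
  proof -
    have ne: "{a \<in> Field k. \<not> f a} \<noteq> {}" using z f by blast
    obtain a where a: "a \<in> {a \<in> Field k. \<not> f a}" "\<forall>x\<in>{a \<in> Field k. \<not> f a}. (a, x) \<in> k"
      using k_least[OF _ ne] by blast
    have am: "K.lt a m" using a(2) z[OF f] m(2)[OF f] K.le_lt_trans by blast
    have "f b = Qfun S b" if b: "K.lt b a" for b
    proof -
      have "f b" using a(2) b K.lt_Field[OF b] K.le_lt_trans K.lt_irrefl by blast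
      moreover have "Qfun S b"
        using Qfun_apply[of b S] K.lt_Field[OF b] K.lt_trans[OF b am] by (simp add: S_def K.underS_lt)
      ultimately show ?thesis by simp
    qed
    moreover have "Qfun S a" using Qfun_apply[of a S] a(1) am by (simp add: S_def K.underS_lt)
    ultimately show ?thesis using a(1) unfolding Qlt_def by blast
  qed
  then show ?thesis using Qfun_carrier[OF S] by blast
qed

text \<open>Recursion along \<open>k\<close>, where regularity provides the next value.\<close>

lemma increasing_above:
  assumes "m \<in> Field k"
  obtains \<phi> where "\<And>i. i \<in> Field k \<Longrightarrow> K.lt m (\<phi> i)" "\<And>i j. K.lt i j \<Longrightarrow> K.lt (\<phi> i) (\<phi> j)"
proof -
  define \<Phi> where "\<Phi> f i v \<longleftrightarrow> (i \<in> Field k \<longrightarrow> K.lt m v \<and> (\<forall>j. K.lt j i \<longrightarrow> K.lt (f j) v))" for f i v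
  have "\<exists>\<phi>. \<forall>i. \<Phi> \<phi> i (\<phi> i)"
  proof (rule dependent_wf_choice)
    show "wf (k - Id)" using k_Well by (simp add: well_order_on_def)
    show "\<Phi> f i r = \<Phi> g i r" if "\<And>j. (j, i) \<in> k - Id \<Longrightarrow> f j = g j" for f g i r
      using that unfolding \<Phi>_def K.lt_def by auto
    show "\<exists>v. \<Phi> f i v" if IH: "\<And>j. (j, i) \<in> k - Id \<Longrightarrow> \<Phi> f j (f j)" for f i
    proof (cases "i \<in> Field k")
      case True
      have "f j \<in> Field k" if "K.lt j i" for j
        using IH[of j] that K.lt_Field unfolding \<Phi>_def K.lt_def by (auto simp: Field_def)
      then have "insert m (f ` underS k i) \<subseteq> Field k" using assms by (auto simp: K.underS_lt)
      moreover have "|insert m (f ` underS k i)| <o k"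
        using underS_k_small[OF True] by (intro insert_small image_small)
      ultimately obtain v where "\<forall>x\<in>insert m (f ` underS k i). K.lt x v" using k_sup by blast
      then show ?thesis unfolding \<Phi>_def K.underS_lt by blast
    qed (simp add: \<Phi>_def)
  qed
  then obtain \<phi> where \<phi>: "\<And>i. \<Phi> \<phi> i (\<phi> i)" by blast
  show ?thesis
  proof (rule that[of \<phi>])
    show "K.lt m (\<phi> i)" if "i \<in> Field k" for i using \<phi>[of i] that unfolding \<Phi>_def by blast
    show "K.lt (\<phi> i) (\<phi> j)" if "K.lt i j" for i j
      using \<phi>[of j] that K.lt_Field(2)[OF that] unfolding \<Phi>_def by blast
  qed
qed

text \<open>Take \<open>m\<close> beyond the support of \<open>f\<close> and beyond the first
  difference \<open>a\<close> from \<open>g\<close>. Functions that agree with \<open>f\<close>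
  below \<open>m\<close> stay below \<open>g\<close>; adding ones from \<open>m\<close> up to
  \<open>\<phi> i\<close>, without and with this endpoint, gives \<open>p i\<close> and
  \<open>s i\<close>.\<close>

lemma Q_interval:
  assumes f: "f \<in> Q_carrier k" and g: "g \<in> Q_carrier k" and fg: "Qlt f g"
  obtains p s where
    "\<And>i. i \<in> Field k \<Longrightarrow> p i \<in> Q_carrier k \<and> s i \<in> Q_carrier k \<and> Qlt f (p i) \<and> Qlt (p i) (s i) \<and> Qlt (s i) g"
    "\<And>i j. K.lt i j \<Longrightarrow> (s i, p j) \<in> Q_order k"
proof -
  obtain a where a: "a \<in> Field k" "\<And>b. K.lt b a \<Longrightarrow> f b = g b" "\<not> f a" "g a"
    using fg unfolding Qlt_def by blast
  define F where "F = {x \<in> Field k. f x}"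
  have F: "F \<subseteq> Field k" "F \<noteq> {}" "|F| <o k" using f by (auto simp: F_def Q_carrier_def)
  obtain m where m: "m \<in> Field k" "\<forall>x\<in>insert a F. K.lt x m"
    using k_sup[of "insert a F"] insert_small[OF F(3)] a(1) F(1) by blast
  obtain \<phi> where \<phi>: "\<And>i. i \<in> Field k \<Longrightarrow> K.lt m (\<phi> i)" "\<And>i j. K.lt i j \<Longrightarrow> K.lt (\<phi> i) (\<phi> j)"
    using increasing_above[OF m(1)] by blast
  define P where "P i = F \<union> {x. (m, x) \<in> k \<and> K.lt x (\<phi> i)}" for i
  define S where "S i = F \<union> {x. (m, x) \<in> k \<and> (x, \<phi> i) \<in> k}" for i
  have fm: "\<not> f x" if "(m, x) \<in> k" for x
    using that m(2) K.le_Field K.le_lt_trans K.lt_irrefl unfolding F_def by blast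
  have PS: "P i \<subseteq> S i" for i using K.lt_le by (auto simp: P_def S_def)
  have SF: "S i \<subseteq> Field k" for i using F(1) K.le_Field by (auto simp: S_def)
  have Ss: "|S i| <o k" if "i \<in> Field k" for i
  proof -
    have "S i \<subseteq> F \<union> insert (\<phi> i) (underS k (\<phi> i))" by (auto simp: S_def underS_def)
    moreover have "|F \<union> insert (\<phi> i) (underS k (\<phi> i))| <o k"
      using F(3) K.lt_Field(2)[OF \<phi>(1)[OF that]] by (intro Un_small insert_small underS_k_small)
    ultimately show ?thesis using card_of_mono1 ordLeq_ordLess_trans by blast
  qed
  have Ps: "|P i| <o k" if "i \<in> Field k" for i
    using card_of_mono1[OF PS] Ss[OF that] ordLeq_ordLess_trans by blast
  have C: "Qfun (P i) \<in> Q_carrier k" "Qfun (S i) \<in> Q_carrier k" if "i \<in> Field k" for i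
    using Qfun_carrier[OF _ _ Ps[OF that]] Qfun_carrier[OF SF _ Ss[OF that]] F(2) PS[of i] SF[of i]
    by (auto simp: P_def S_def)
  have low: "Qfun (P i) x = f x" "Qfun (S i) x = f x" if "K.lt x m" for x i
  proof -
    have "(m, x) \<notin> k" using that K.le_lt_trans K.lt_irrefl by blast
    then show "Qfun (P i) x = f x" "Qfun (S i) x = f x"
      using K.lt_Field[OF that] by (auto simp: Qfun_def P_def S_def F_def)
  qed
  have 1: "Qlt f (Qfun (P i))" if "i \<in> Field k" for i
  proof -
    have "m \<in> P i" using \<phi>(1)[OF that] K.le_refl m by (simp add: P_def)
    then show ?thesis
      unfolding Qlt_def using m(1) low(1) fm[OF K.le_refl[OF m(1)]] Qfun_apply[OF m(1)] by blast
  qed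
  have 2: "Qlt (Qfun (P i)) (Qfun (S i))" if i: "i \<in> Field k" for i
  proof -
    have \<phi>F: "\<phi> i \<in> Field k" "(m, \<phi> i) \<in> k" using \<phi>(1)[OF i] K.lt_Field K.lt_le by blast+
    have "\<phi> i \<notin> P i" using fm[OF \<phi>F(2)] K.lt_irrefl by (auto simp: P_def F_def)
    moreover have "\<phi> i \<in> S i" using \<phi>F K.le_refl by (simp add: S_def)
    moreover have "Qfun (P i) b = Qfun (S i) b" if "K.lt b (\<phi> i)" for b
      using that K.lt_le by (auto simp: Qfun_def P_def S_def)
    ultimately show ?thesis unfolding Qlt_def using \<phi>F Qfun_apply[OF \<phi>F(1)] by blast
  qed
  have 3: "Qlt (Qfun (S i)) g" for i
  proof -
    have am: "K.lt a m" using m by blast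
    have "Qfun (S i) b = g b" if "K.lt b a" for b
      using low(2)[OF K.lt_trans[OF that am]] a(2)[OF that] by simp
    moreover have "\<not> Qfun (S i) a" using low(2)[OF am] a(3) by simp
    ultimately show ?thesis unfolding Qlt_def using a by blast
  qed
  have 4: "(Qfun (S i), Qfun (P j)) \<in> Q_order k" if ij: "K.lt i j" for i j
  proof -
    \<comment> \<open>A larger support is also larger or equal lexicographically.\<close>
    have "S i \<subseteq> P j" using K.le_lt_trans \<phi>(2)[OF ij] by (auto simp: S_def P_def)
    then have "\<not> Qlt (Qfun (P j)) (Qfun (S i))" using Qfun_apply unfolding Qlt_def by blast
    then show ?thesis
      using C K.lt_Field[OF ij] Qlt_total[of "Qfun (S i)" "Qfun (P j)"] unfolding Q_order_iff by blast
  qed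
  show ?thesis by (rule that[of "\<lambda>i. Qfun (P i)" "\<lambda>i. Qfun (S i)"]) (use C 1 2 3 4 in auto)
qed

text \<open>A support is bounded by some \<open>a\<close>, so its function is coded by a sequence of
  length \<open>a\<close> with the two values \<open>x0\<close> and \<open>x1\<close>. The singleton
  supports give the lower bound.\<close>

lemma Q_card:
  assumes "|short_sequences k| =o k"
  shows "|Q_carrier k| =o k"
proof -
  have "|Field k| \<le>o |Q_carrier k|"
  proof -
    have "inj_on (\<lambda>a. Qfun {a}) (Field k)"
      using Qfun_apply by (intro inj_onI) (metis singleton_iff)
    moreover have "(\<lambda>a. Qfun {a}) ` Field k \<subseteq> Q_carrier k"
      using Qfun_carrier[OF _ _ finite_small] by auto
    ultimately show ?thesis using card_of_ordLeq by blast
  qed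
  then have 1: "k \<le>o |Q_carrier k|"
    using ordIso_ordLeq_trans[OF ordIso_symmetric[OF card_of_Field_ordIso[OF k_card]]] by blast
  obtain x0 where x0: "x0 \<in> Field k" using k_inf by fastforce
  obtain x1 where "K.lt x0 x1" using k_no_max[OF x0] by blast
  then have x1: "x1 \<in> Field k" "x1 \<noteq> x0" using K.lt_Field K.lt_irrefl by blast+
  have "Q_carrier k \<subseteq> (\<lambda>(a, h). Qfun {b. K.lt b a \<and> h b = x1}) ` short_sequences k"
  proof
    fix f assume f: "f \<in> Q_carrier k"
    obtain a where a: "a \<in> Field k" "\<And>x. x \<in> Field k \<Longrightarrow> f x \<Longrightarrow> K.lt x a" using Q_bound[OF f] by blast
    define h where "h b = (if b \<in> underS k a then (if f b then x1 else x0) else undefined)" for b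
    have "h \<in> Func (underS k a) (Field k)" using x0 x1 by (auto simp: Func_def h_def)
    then have "(a, h) \<in> short_sequences k" using a by (simp add: short_sequences_def)
    moreover have "f = Qfun {b. K.lt b a \<and> h b = x1}"
    proof
      fix x show "f x = Qfun {b. K.lt b a \<and> h b = x1} x"
        using f a(2)[of x] x1(2) by (auto simp: Qfun_def h_def K.underS_lt Q_carrier_def Func_def)
    qed
    ultimately show "f \<in> (\<lambda>(a, h). Qfun {b. K.lt b a \<and> h b = x1}) ` short_sequences k"
      by (intro image_eqI[of _ _ "(a, h)"]) auto
  qed
  then have "|Q_carrier k| \<le>o |short_sequences k|"
    using ordLeq_transitive[OF card_of_mono1 card_of_image] by blast
  then have "|Q_carrier k| \<le>o k" using ordLeq_ordIso_trans assms by blast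
  then show ?thesis using 1 ordIso_iff_ordLeq by blast
qed

text \<open>Having size \<open>k\<close>, the order can be transported to the field of
  \<open>k\<close>, so that nodes get the type \<open>'a set\<close>.\<close>

lemma Q_copy:
  assumes "|short_sequences k| =o k"
  obtains q :: "'a rel" and e where "Linear_order q" "Field q = Field k"
    "\<And>x. x \<in> Field q \<Longrightarrow> e x \<in> Field (Q_order k)"
    "\<And>x y. x \<in> Field q \<Longrightarrow> y \<in> Field q \<Longrightarrow> (e x, e y) \<in> Q_order k \<longleftrightarrow> (x, y) \<in> q"
    "\<And>A. A \<subseteq> Field q \<Longrightarrow> |A| <o k \<Longrightarrow> \<exists>b\<in>Field q. \<forall>a\<in>A. (a, b) \<in> q \<and> a \<noteq> b"
    "\<And>b b'. (b, b') \<in> q \<Longrightarrow> b \<noteq> b' \<Longrightarrow> \<exists>p s.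
      (\<forall>i\<in>Field k. (b, p i) \<in> q \<and> (p i, s i) \<in> q \<and> p i \<noteq> s i \<and> (s i, b') \<in> q \<and> s i \<noteq> b') \<and>
      (\<forall>i j. (i, j) \<in> k \<and> i \<noteq> j \<longrightarrow> (s i, p j) \<in> q)"
proof -
  have "|Field k| =o |Q_carrier k|"
    using ordIso_transitive[OF card_of_Field_ordIso[OF k_card] ordIso_symmetric[OF Q_card[OF assms]]] .
  then obtain e where bij: "bij_betw e (Field k) (Q_carrier k)" using card_of_ordIso by blast
  define e' where "e' = inv_into (Field k) e"
  have e: "e x \<in> Q_carrier k" if "x \<in> Field k" for x using bij_betwE[OF bij] that by blast
  have e': "e' f \<in> Field k" "e (e' f) = f" if "f \<in> Q_carrier k" for f
    using bij_betwE[OF bij_betw_inv_into[OF bij]] bij_betw_inv_into_right[OF bij that] that by (auto simp: e'_def)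
  have inj: "e x = e y \<longleftrightarrow> x = y" if "x \<in> Field k" "y \<in> Field k" for x y
    using bij that by (auto simp: bij_betw_def inj_on_def)
  define q where "q = {(x, y). x \<in> Field k \<and> y \<in> Field k \<and> (e x, e y) \<in> Q_order k}"
  have q_iff: "(x, y) \<in> q \<longleftrightarrow> x \<in> Field k \<and> y \<in> Field k \<and> (x = y \<or> Qlt (e x) (e y))" for x y
    using e inj by (auto simp: q_def Q_order_iff)
  have F: "Field q = Field k" by (auto simp: Field_def[of q] q_iff)
  have Qlt_q: "Qlt (e x) (e y) \<Longrightarrow> x \<in> Field k \<Longrightarrow> y \<in> Field k \<Longrightarrow> (x, y) \<in> q \<and> x \<noteq> y" for x y
    using Qlt_irrefl by (auto simp: q_iff)
  show ?thesis
  proof (rule that[of q e])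
    show "Linear_order q"
      unfolding order_on_defs F refl_on_def trans_def antisym_def total_on_def
    proof (intro conjI ballI allI impI)
      show "q \<subseteq> Field k \<times> Field k" by (auto simp: q_iff)
      show "(x, x) \<in> q" if "x \<in> Field k" for x using that by (simp add: q_iff)
      show "(x, z) \<in> q" if "(x, y) \<in> q" "(y, z) \<in> q" for x y z
        using that Qlt_trans by (auto simp: q_iff)
      show "x = y" if "(x, y) \<in> q" "(y, x) \<in> q" for x y
        using that Qlt_trans Qlt_irrefl by (auto simp: q_iff)
      show "(x, y) \<in> q \<or> (y, x) \<in> q" if "x \<in> Field k" "y \<in> Field k" "x \<noteq> y" for x y
        using that Qlt_total[OF e e, of x y] inj by (auto simp: q_iff)
    qed
    show "Field q = Field k" by (rule F)
    show "e x \<in> Field (Q_order k)" if "x \<in> Field q" for x using that e Field_Q_order F by simp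
    show "(e x, e y) \<in> Q_order k \<longleftrightarrow> (x, y) \<in> q" if "x \<in> Field q" "y \<in> Field q" for x y
      using that F by (simp add: q_def)
    show "\<exists>b\<in>Field q. \<forall>a\<in>A. (a, b) \<in> q \<and> a \<noteq> b" if A: "A \<subseteq> Field q" "|A| <o k" for A
    proof -
      have "e ` A \<subseteq> Q_carrier k" using A(1) e F by blast
      then obtain g where g: "g \<in> Q_carrier k" "\<forall>f\<in>e ` A. Qlt f g"
        using Q_bounded[OF _ image_small[OF A(2)]] by blast
      have "(a, e' g) \<in> q \<and> a \<noteq> e' g" if "a \<in> A" for a
        using Qlt_q[of a "e' g"] e'[OF g(1)] g(2) that A(1) F by auto
      then show ?thesis using e'[OF g(1)] F by blast
    qed
    show "\<exists>p s. (\<forall>i\<in>Field k. (b, p i) \<in> q \<and> (p i, s i) \<in> q \<and> p i \<noteq> s i \<and> (s i, b') \<in> q \<and> s i \<noteq> b') \<and>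
      (\<forall>i j. (i, j) \<in> k \<and> i \<noteq> j \<longrightarrow> (s i, p j) \<in> q)" if b: "(b, b') \<in> q" "b \<noteq> b'" for b b'
    proof -
      have bF: "b \<in> Field k" "b' \<in> Field k" "Qlt (e b) (e b')" using b by (auto simp: q_iff)
      obtain p s where ps: "\<And>i. i \<in> Field k \<Longrightarrow> p i \<in> Q_carrier k \<and> s i \<in> Q_carrier k \<and> Qlt (e b) (p i) \<and> Qlt (p i) (s i) \<and> Qlt (s i) (e b')"
        "\<And>i j. K.lt i j \<Longrightarrow> (s i, p j) \<in> Q_order k"
        using Q_interval[OF e[OF bF(1)] e[OF bF(2)] bF(3)] by blast
      have A: "(b, e' (p i)) \<in> q \<and> (e' (p i), e' (s i)) \<in> q \<and> e' (p i) \<noteq> e' (s i) \<and> (e' (s i), b') \<in> q \<and> e' (s i) \<noteq> b'"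
        if "i \<in> Field k" for i
        using ps(1)[OF that] e'[of "p i"] e'[of "s i"] bF Qlt_q[of b "e' (p i)"] Qlt_q[of "e' (p i)" "e' (s i)"]
          Qlt_q[of "e' (s i)" b'] by auto
      have B: "(e' (s i), e' (p j)) \<in> q" if "(i, j) \<in> k \<and> i \<noteq> j" for i j
      proof -
        have ij: "K.lt i j" using that by (simp add: K.lt_def)
        show ?thesis
          using ps(2)[OF ij] ps(1)[OF K.lt_Field(1)[OF ij]] ps(1)[OF K.lt_Field(2)[OF ij]] e'[of "s i"] e'[of "p j"]
          by (simp add: q_def)
      qed
      show ?thesis using A B by (intro exI[of _ "\<lambda>i. e' (p i)"] exI[of _ "\<lambda>i. e' (s i)"]) blast
    qed
  qed
qed

end

section \<open>Two trees\<close>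

context tree_setting
begin

text \<open>A tree is built against the given \<open>u\<close>. If \<open>u\<close> is not a tree of
  the right kind, there is nothing to avoid and a trivial demand serves.\<close>

lemma tree_avoiding:
  fixes u :: "'a set rel"
  assumes pow: "ctwo ^c k =o l" and unc: "natLeq <o k"
    and e: "\<And>x. x \<in> Field q \<Longrightarrow> e x \<in> Field (Q_order k)"
      "\<And>x y. x \<in> Field q \<Longrightarrow> y \<in> Field q \<Longrightarrow> (e x, e y) \<in> Q_order k \<longleftrightarrow> (x, y) \<in> q"
    and box: "\<And>X. unbounded_in l (Field l) X \<Longrightarrow>
      stationary l {d \<in> cof_points l k. unbounded_in l (underS l d) ((C d \<inter> X) - limit_points l (C d))}"
  shows "\<exists>t :: 'a set rel. aronszajn_tree l t \<and> normal_tree l t \<and> complete_tree k t \<and> R_embeddable k t \<and>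
    (lambda_tree l u \<longrightarrow> \<not> club_isomorphic l t u)"
proof -
  have tree: "\<exists>P. tree_family k q q0 C D P" for D
  proof -
    obtain P where "\<forall>d. P d = chosen D (nodes_below P d) d" using ex_chosen by blast
    then have "tree_family k q q0 C D P" by unfold_locales blast
    then show ?thesis by blast
  qed
  show ?thesis
  proof (cases "lambda_tree l u")
    case False
    obtain P where "tree_family k q q0 C (\<lambda>_ _ _ _. True) P" using tree by blast
    then interpret tree_family k q q0 C "\<lambda>_ _ _ _. True" P .
    show ?thesis
      using aronszajn_tree_tree normal_tree_tree complete_tree_tree R_embeddable_tree[OF e] False by blast
  next
    case u: True
    have lev: "|level l u d| \<le>o k" if "d \<in> Field l" for d
      using u that less_l unfolding lambda_tree_def by blast
    \<comment> \<open>On these levels \<open>C d\<close> has size \<open>k\<close>, enough to rank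
      the at most \<open>k\<close> nodes of level \<open>d\<close> of \<open>u\<close>.\<close>
    have "\<exists>r. inj_on r (level l u d) \<and> r ` level l u d \<subseteq> C d" if d: "d \<in> branching" for d
    proof -
      have dF: "d \<in> Field l" and iso: "Restr l (C d) =o k" using d by (auto simp: branching_def)
      have "|C d| =o |Field k|"
        using card_of_cong[OF iso] by (simp add: l.well_ordered_Field_Restr[OF C_well_ordered[OF dF]])
      then have "|C d| =o k" using card_of_Field_ordIso[OF k_card] ordIso_transitive by blast
      then have "|level l u d| \<le>o |C d|"
        by (rule ordLeq_ordIso_trans[OF lev[OF dF] ordIso_symmetric])
      then show ?thesis using card_of_ordLeq[of "level l u d" "C d"] by simp
    qed
    then have "\<forall>d. \<exists>r. d \<in> branching \<longrightarrow> inj_on r (level l u d) \<and> r ` level l u d \<subseteq> C d" by blast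
    then obtain r where r: "\<And>d. d \<in> branching \<Longrightarrow> inj_on (r d) (level l u d) \<and> r d ` level l u d \<subseteq> C d"
      by metis
    \<comment> \<open>The graphs to be guessed are subsets of
      \<open>Pow (Field q) \<times> Field u\<close>, which has size at most \<open>k^+\<close>
      because \<open>2^k = k^+\<close>.\<close>
    have "|Pow (Field q)| =o |Func (Field k) (UNIV :: bool set)|" unfolding q_Field by (rule card_of_Pow_Func)
    moreover have "|Func (Field k) (UNIV :: bool set)| = ctwo ^c k"
      by (simp add: cexp_def ctwo_def Field_card_of)
    ultimately have P: "|Pow (Field q)| \<le>o l"
      using pow ordIso_transitive ordIso_imp_ordLeq by metis
    have "|\<Union>a\<in>Field l. level l u a| \<le>o l"
      by (rule card_of_UNION_ordLeq_infinite_Field[OF l_inf l_card Field_l])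
        (use lev ordLeq_transitive[OF _ cardSuc_ordLeq[OF k_card]] in blast)
    then have "|Field u| \<le>o l" using u unfolding lambda_tree_def by simp
    then have N: "|Pow (Field q) \<times> Field u| \<le>o l"
      using card_of_Times_ordLeq_infinite_Field[OF l_inf P _ l_card] by blast
    show ?thesis
    proof (rule guessing[OF pow unc N])
      fix G :: "'a set \<Rightarrow> 'a \<Rightarrow> ('a set \<times> 'a set) set"
      assume G: "\<And>F E. (\<And>b. b \<in> Field l \<Longrightarrow> F b \<subseteq> Pow (Field q) \<times> Field u \<and> |F b| \<le>o k) \<Longrightarrow>
        (\<And>b b'. (b, b') \<in> l \<Longrightarrow> F b \<subseteq> F b') \<Longrightarrow>
        (\<And>c. c \<in> Field l \<Longrightarrow> limit_ht c \<Longrightarrow> F c \<subseteq> (\<Union>b\<in>underS l c. F b)) \<Longrightarrow>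
        unbounded_in l (Field l) E \<Longrightarrow>
        \<exists>\<xi>\<in>Field k. unbounded_in l (Field l)
          {c \<in> Field l. G c \<xi> = F c \<and> (\<forall>b. l.lt b c \<longrightarrow> (\<exists>g\<in>E. l.lt b g \<and> l.lt g c))}"
      define D where "D d \<xi> c z \<longleftrightarrow>
        (\<exists>v. (z, v) \<in> G c \<xi> \<and> (\<forall>y\<in>level l u d. l.lt (r d y) c \<longrightarrow> (v, y) \<notin> u))" for d \<xi> c z
      obtain P where "tree_family k q q0 C D P" using tree by blast
      then interpret tree_family k q q0 C D P .
      have "\<not> club_isomorphic l tree u"
        by (rule not_club_isomorphic[OF u G r D_def box])
      then show ?thesis
        using aronszajn_tree_tree normal_tree_tree complete_tree_tree R_embeddable_tree[OF e] by blast
    qed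
  qed
qed

end

theorem theorem2p1:
  fixes k :: "'a rel"
  assumes "Card_order k" and "natLeq <o k" and "regularCard k"
    and "|short_sequences k| =o k"
    and "ctwo ^c k =o cardSuc k"
    and "boxtimes_star k (cof_points (cardSuc k) k)"
  shows "\<exists>(T :: 'a set rel) (U :: 'a set rel).
    aronszajn_tree (cardSuc k) T \<and> normal_tree (cardSuc k) T \<and> complete_tree k T \<and> R_embeddable k T \<and>
    aronszajn_tree (cardSuc k) U \<and> normal_tree (cardSuc k) U \<and> complete_tree k U \<and> R_embeddable k U \<and>
    \<not> club_isomorphic (cardSuc k) T U"
proof -
  have inf: "infinite (Field k)"
    using card_of_mono2[OF ordLess_imp_ordLeq[OF assms(2)]] card_of_ordLeq_infinite by (auto simp: Field_natLeq)
  interpret regular_cardinal k using assms(1,3) inf by unfold_locales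
  show ?thesis
  proof (rule Q_copy[OF assms(4)])
    fix q :: "'a rel" and e
    assume q: "Linear_order q" "Field q = Field k"
      "\<And>x. x \<in> Field q \<Longrightarrow> e x \<in> Field (Q_order k)"
      "\<And>x y. x \<in> Field q \<Longrightarrow> y \<in> Field q \<Longrightarrow> (e x, e y) \<in> Q_order k \<longleftrightarrow> (x, y) \<in> q"
      "\<And>A. A \<subseteq> Field q \<Longrightarrow> |A| <o k \<Longrightarrow> \<exists>b\<in>Field q. \<forall>a\<in>A. (a, b) \<in> q \<and> a \<noteq> b"
      "\<And>b b'. (b, b') \<in> q \<Longrightarrow> b \<noteq> b' \<Longrightarrow> \<exists>p s.
        (\<forall>i\<in>Field k. (b, p i) \<in> q \<and> (p i, s i) \<in> q \<and> p i \<noteq> s i \<and> (s i, b') \<in> q \<and> s i \<noteq> b') \<and>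
        (\<forall>i j. (i, j) \<in> k \<and> i \<noteq> j \<longrightarrow> (s i, p j) \<in> q)"
    obtain q0 where q0: "q0 \<in> Field q" using inf q(2) by fastforce
    obtain C :: "'a set \<Rightarrow> 'a set set" where
      C: "\<And>d. d \<in> Field (cardSuc k) \<Longrightarrow> club_in (cardSuc k) (underS (cardSuc k) d) (C d) \<and> Restr (cardSuc k) (C d) \<le>o k"
      and box: "\<And>X. unbounded_in (cardSuc k) (Field (cardSuc k)) X \<Longrightarrow> stationary (cardSuc k)
        {d \<in> cof_points (cardSuc k) k. unbounded_in (cardSuc k) (underS (cardSuc k) d)
          ((C d \<inter> X) - limit_points (cardSuc k) (C d))}"
      using assms(6) unfolding boxtimes_star_def Let_def by blast
    have seqs: "|Func (underS k a) (Field k)| \<le>o k" if a: "a \<in> Field k" for a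
    proof -
      have "Pair a ` Func (underS k a) (Field k) \<subseteq> short_sequences k" using a by (auto simp: short_sequences_def)
      then have "|Func (underS k a) (Field k)| \<le>o |short_sequences k|"
        using card_of_ordLeq inj_onI[of "Func (underS k a) (Field k)" "Pair a"] by blast
      then show ?thesis using assms(4) ordLeq_ordIso_trans by blast
    qed
    interpret tree_setting k q q0 C
      by unfold_locales (use q q0 C seqs in \<open>auto simp: club_in_def\<close>)
    note avoid = tree_avoiding[OF assms(5,2) q(3,4) box]
    \<comment> \<open>The first application only serves to obtain some tree \<open>U\<close>; the
      second one builds \<open>T\<close> against it.\<close>
    obtain U :: "'a set rel" where U: "aronszajn_tree l U \<and> normal_tree l U \<and> complete_tree k U \<and> R_embeddable k U"
      using avoid[of "{}"] by blast
    obtain T :: "'a set rel" where "aronszajn_tree l T \<and> normal_tree l T \<and> complete_tree k T \<and> R_embeddable k T"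
      "lambda_tree l U \<longrightarrow> \<not> club_isomorphic l T U"
      using avoid[of U] by blast
    then show ?thesis using U unfolding aronszajn_tree_def by blast
  qed
qed

end
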